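(* Let $\rho\in\mathcal{P}(\Omega)$ and $\kappa\in(0,\infty)$. Consider the primal problem $$(\mathcal P_{\rho,\kappa})\qquad\inf\Big\{J_{\rho,\kappa}(\nu):=\int_\Omega\mathrm{HK}_\kappa^2(\delta_x,\nu)\,d\rho(x)\;\Big|\;\nu\in\mathcal{M}_+(\Omega)\Big\}$$ and the problem $$(\mathcal D_{\rho,\kappa})\qquad\sup\Big\{\int_\Omega\psi\,d\rho\;\Big|\;\psi\in C(\Omega),\ \psi<1,\ F_{\rho,\kappa}(\psi)(y):=\int_\Omega\frac{\mathrm{Cos}^2(|x-y|/\kappa)}{1-\psi(x)}\,d\rho(x)\le1\ \text{for all }y\in\Omega\Big\}.$$ Then: (i) $(\mathcal D_{\rho,\kappa})$ is a dual problem to $(\mathcal P_{\rho,\kappa})$, and their optimal values are equal; (ii) $(\mathcal D_{\rho,\kappa})$ admits a maximizer $\psi\in C(\Omega)$ which is unique on the support of $\rho$, and for any primal optimizer $\nu$ we have $$(\ast)\qquad\psi(x)=1-\sqrt{\int_\Omega\mathrm{Cos}^2(|x-y|/\kappa)\,d\nu(y)}\ \text{ for }\rho\text{-a.e. }x\in\Omega,\qquad F_{\rho,\kappa}(\psi)(y)=1\ \text{ for }\nu\text{-a.e. }y\in\Omega;$$ (iii) an admissible couple $(\nu,\psi)\in\mathcal{M}_+(\Omega)\times C(\Omega)$ is optimal (i.e. $\nu$ is a primal minimizer and $\psi$ a dual maximizer) if and only if $(\ast)$ holds.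
   Context: $\Omega \subset \mathbb{R}^d$ is a compact convex set with non-empty interior. $C(\Omega)$ denotes the continuous real functions on $\Omega$, $\mathcal{M}_+(\Omega)$ and $\mathcal{P}(\Omega)$ the non-negative Radon measures and the probability measures on $\Omega$. $\mathrm{Cos}(s):=\cos(\min\{|s|,\pi/2\})$. A couple $(\nu,\psi)$ is admissible if $\nu$ is feasible for $(\mathcal P_{\rho,\kappa})$ and $\psi$ is feasible for $(\mathcal D_{\rho,\kappa})$. For $\kappa\in(0,\infty)$ and $\mu,\nu\in\mathcal{M}_+(\Omega)$ the Hellinger--Kantorovich distance is $$\mathrm{HK}_\kappa^2(\mu,\nu) := \inf_{\gamma\in\mathcal{M}_+(\Omega\times\Omega)} \int \hat c_\kappa\,d\gamma + \mathrm{KL}(P_1\gamma|\mu)+\mathrm{KL}(P_2\gamma|\nu),$$ where $P_1\gamma,P_2\gamma$ are the two marginals of $\gamma$, $\hat c_\kappa(x,y) = -2\log\cos(|x-y|/\kappa)$ if $|x-y|\le\kappa\pi/2$ (with $-\log 0=+\infty$) and $+\infty$ otherwise, and $\mathrm{KL}(\mu|\nu)=\int\varphi(d\mu/d\nu)\,d\nu$ if $\mu\ll\nu$, $\mu\ge0$, and $+\infty$ otherwise, with $\varphi(s)=s\log s-s+1$ for $s>0$, $\varphi(0)=1$, $\varphi(s)=+\infty$ for $s<0$.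
   Formalization: The constraint ψ < 1 is imposed ρ-almost everywhere with ψ ≤ 1 on all of Ω, since with ψ < 1 at every point a maximizer need not exist; equality of the optimal values is also proved for ψ < 1 everywhere. *)

theory Defs
  imports "HOL-Probability.Probability"
begin

text \<open>
  On a compact set \<open>S\<close> of a Euclidean space every finite Borel measure is Radon, so the
  non-negative Radon measures on \<open>S\<close> are the finite measures on the Borel sets of \<open>S\<close>.
\<close>

definition radon_measures :: "'a::euclidean_space set \<Rightarrow> 'a measure set" where
  "radon_measures S = {\<mu>. sets \<mu> = sets (restrict_space borel S) \<and> finite_measure \<mu>}"

definition measure_support :: "'a::euclidean_space set \<Rightarrow> 'a measure \<Rightarrow> 'a set" where
  "measure_support S \<mu> = {x \<in> S. \<forall>U. open U \<and> x \<in> U \<longrightarrow> emeasure \<mu> (U \<inter> S) > 0}"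

definition trunc_cos :: "real \<Rightarrow> real" where
  "trunc_cos s = cos (min \<bar>s\<bar> (pi / 2))"

text \<open>The expression \<open>s * ln s - s + 1\<close> is non-negative for \<open>s > 0\<close>, so \<open>ennreal\<close> truncates nothing.\<close>

definition entropy_fun :: "real \<Rightarrow> ennreal" where
  "entropy_fun s =
     (if s > 0 then ennreal (s * ln s - s + 1) else if s = 0 then 1 else \<infinity>)"

text \<open>
  The library constant \<open>absolutely_continuous \<nu> \<mu>\<close> says that \<open>\<mu>\<close> is absolutely continuous with
  respect to \<open>\<nu>\<close>, and \<open>RN_deriv \<nu> \<mu>\<close> is then the density of \<open>\<mu>\<close>. It is finite almost everywhere
  for finite measures, so \<open>enn2real\<close> is harmless.
\<close>

definition KL :: "'a measure \<Rightarrow> 'a measure \<Rightarrow> ennreal" where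
  "KL \<mu> \<nu> =
     (if absolutely_continuous \<nu> \<mu> then \<integral>\<^sup>+x. entropy_fun (enn2real (RN_deriv \<nu> \<mu> x)) \<partial>\<nu> else \<infinity>)"

text \<open>At distance \<open>\<kappa> * pi / 2\<close> the value is \<open>\<infinity>\<close>, from \<open>- log 0 = \<infinity>\<close>; HOL has \<open>ln 0 = 0\<close>.\<close>

definition hk_cost :: "real \<Rightarrow> 'a::euclidean_space \<Rightarrow> 'a \<Rightarrow> ennreal" where
  "hk_cost \<kappa> x y =
     (if dist x y < \<kappa> * pi / 2 then ennreal (- 2 * ln (cos (dist x y / \<kappa>))) else \<infinity>)"

definition HK2 ::
  "'a::euclidean_space set \<Rightarrow> real \<Rightarrow> 'a measure \<Rightarrow> 'a measure \<Rightarrow> ennreal" where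
  "HK2 \<Omega> \<kappa> \<mu> \<nu> =
     (INF \<gamma> \<in> radon_measures (\<Omega> \<times> \<Omega>).
        (\<integral>\<^sup>+z. hk_cost \<kappa> (fst z) (snd z) \<partial>\<gamma>)
        + KL (distr \<gamma> (restrict_space borel \<Omega>) fst) \<mu>
        + KL (distr \<gamma> (restrict_space borel \<Omega>) snd) \<nu>)"

definition primal_objective ::
  "'a::euclidean_space set \<Rightarrow> 'a measure \<Rightarrow> real \<Rightarrow> 'a measure \<Rightarrow> ennreal" where
  "primal_objective \<Omega> \<rho> \<kappa> \<nu> =
     (\<integral>\<^sup>+x. HK2 \<Omega> \<kappa> (return (restrict_space borel \<Omega>) x) \<nu> \<partial>\<rho>)"

definition dual_objective :: "'a::euclidean_space measure \<Rightarrow> ('a \<Rightarrow> real) \<Rightarrow> real" where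
  "dual_objective \<rho> \<psi> = (LINT x|\<rho>. \<psi> x)"

text \<open>
  Extended-valued, so that a divergent integral violates \<open>dual_potential \<rho> \<kappa> \<psi> y \<le> 1\<close>
  (the Bochner integral would be \<open>0\<close>).
\<close>

definition dual_potential ::
  "'a::euclidean_space measure \<Rightarrow> real \<Rightarrow> ('a \<Rightarrow> real) \<Rightarrow> 'a \<Rightarrow> ennreal" where
  "dual_potential \<rho> \<kappa> \<psi> y =
     (\<integral>\<^sup>+x. ennreal ((trunc_cos (dist x y / \<kappa>))\<^sup>2 / (1 - \<psi> x)) \<partial>\<rho>)"

text \<open>
  The constraint \<open>\<psi> < 1\<close> is understood \<open>\<rho>\<close>-almost everywhere, with \<open>\<psi> \<le> 1\<close> on all of \<open>\<Omega>\<close>.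
  If \<open>\<psi> < 1\<close> is demanded at every point of \<open>\<Omega>\<close>, the supremum is the same but it need not be
  attained. On \<open>{0..pi}\<close> with \<open>\<kappa> = 1\<close>, let \<open>\<rho>\<close> be proportional to the sum of a unit mass at
  \<open>pi / 2\<close>, a small density \<open>\<epsilon> * x\<close> on \<open>{0..1}\<close>, and a mass at \<open>3 * pi / 4\<close> that balances it so
  that the primal problem is solved by a point mass at \<open>pi / 2\<close>. Then the only continuous
  candidate near \<open>0\<close> is \<open>1 - c * sin x\<close>, and it equals \<open>1\<close> at the point \<open>0\<close> of the support.
\<close>

definition dual_potentials :: "'a::euclidean_space set \<Rightarrow> 'a measure \<Rightarrow> ('a \<Rightarrow> real) set" where
  "dual_potentials \<Omega> \<rho> =
     {\<psi>. continuous_on \<Omega> \<psi> \<and> (\<forall>x\<in>\<Omega>. \<psi> x \<le> 1) \<and> (AE x in \<rho>. \<psi> x < 1)}"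

definition dual_feasible ::
  "'a::euclidean_space set \<Rightarrow> 'a measure \<Rightarrow> real \<Rightarrow> ('a \<Rightarrow> real) set" where
  "dual_feasible \<Omega> \<rho> \<kappa> =
     {\<psi> \<in> dual_potentials \<Omega> \<rho>. \<forall>y\<in>\<Omega>. dual_potential \<rho> \<kappa> \<psi> y \<le> 1}"

definition primal_optimal ::
  "'a::euclidean_space set \<Rightarrow> 'a measure \<Rightarrow> real \<Rightarrow> 'a measure \<Rightarrow> bool" where
  "primal_optimal \<Omega> \<rho> \<kappa> \<nu> \<longleftrightarrow>
     is_arg_min (primal_objective \<Omega> \<rho> \<kappa>) (\<lambda>\<nu>. \<nu> \<in> radon_measures \<Omega>) \<nu>"

definition dual_optimal ::
  "'a::euclidean_space set \<Rightarrow> 'a measure \<Rightarrow> real \<Rightarrow> ('a \<Rightarrow> real) \<Rightarrow> bool" where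
  "dual_optimal \<Omega> \<rho> \<kappa> \<psi> \<longleftrightarrow>
     is_arg_max (dual_objective \<rho>) (\<lambda>\<psi>. \<psi> \<in> dual_feasible \<Omega> \<rho> \<kappa>) \<psi>"

text \<open>
  The Lagrangian of the dual problem, with the measure \<open>\<nu>\<close> as multiplier for the constraint
  \<open>dual_potential \<rho> \<kappa> \<psi> \<le> 1\<close>: it is \<open>\<integral> \<psi> d\<rho> + \<integral> (1 - dual_potential \<rho> \<kappa> \<psi>) d\<nu>\<close>, with the
  second integral split so that only the subtracted term can be infinite.
\<close>

definition lagrangian ::
  "'a::euclidean_space measure \<Rightarrow> real \<Rightarrow> ('a \<Rightarrow> real) \<Rightarrow> 'a measure \<Rightarrow> ereal" where
  "lagrangian \<rho> \<kappa> \<psi> \<nu> =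
     ereal (dual_objective \<rho> \<psi> + measure \<nu> (space \<nu>))
     - enn2ereal (\<integral>\<^sup>+y. dual_potential \<rho> \<kappa> \<psi> y \<partial>\<nu>)"

text \<open>
  Being a dual problem: the primal objective is the supremum of the Lagrangian over the
  potentials, and the dual objective (\<open>-\<infinity>\<close> off the feasible set) is its infimum over the measures.
\<close>

definition is_dual_problem ::
  "'a::euclidean_space set \<Rightarrow> 'a measure \<Rightarrow> real \<Rightarrow> bool" where
  "is_dual_problem \<Omega> \<rho> \<kappa> \<longleftrightarrow>
     (\<forall>\<nu> \<in> radon_measures \<Omega>.
        enn2ereal (primal_objective \<Omega> \<rho> \<kappa> \<nu>) =
        (SUP \<psi> \<in> dual_potentials \<Omega> \<rho>. lagrangian \<rho> \<kappa> \<psi> \<nu>)) \<and>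
     (\<forall>\<psi> \<in> dual_potentials \<Omega> \<rho>.
        (if \<psi> \<in> dual_feasible \<Omega> \<rho> \<kappa> then ereal (dual_objective \<rho> \<psi>) else -\<infinity>) =
        (INF \<nu> \<in> radon_measures \<Omega>. lagrangian \<rho> \<kappa> \<psi> \<nu>))"

definition optimality_conditions ::
  "'a::euclidean_space measure \<Rightarrow> real \<Rightarrow> 'a measure \<Rightarrow> ('a \<Rightarrow> real) \<Rightarrow> bool" where
  "optimality_conditions \<rho> \<kappa> \<nu> \<psi> \<longleftrightarrow>
     (AE x in \<rho>. \<psi> x = 1 - sqrt (LINT y|\<nu>. (trunc_cos (dist x y / \<kappa>))\<^sup>2)) \<and>
     (AE y in \<nu>. dual_potential \<rho> \<kappa> \<psi> y = 1)"

end

theory Submission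
  imports Defs "HOL-Complex_Analysis.Great_Picard"
begin

text \<open>
  Write \<open>k(x, y) = Cos\<^sup>2(|x - y| / \<kappa>)\<close> and \<open>K \<nu> x = \<integral> k(x, y) d\<nu>(y)\<close>. A plan with first marginal
  absolutely continuous with respect to \<open>\<delta>\<^sub>x\<close> lives on \<open>{x} \<times> \<Omega>\<close>, so the transport problem from \<open>\<delta>\<^sub>x\<close> to \<open>\<nu>\<close>
  is solved explicitly by a multiple of \<open>k(x, \<cdot>) \<nu>\<close>, and the primal objective is
  \<open>1 + \<nu>(\<Omega>) - 2 \<integral> sqrt (K \<nu>) d\<rho>\<close>. The identity
  \<open>1 - 2 * sqrt g + g / (1 - \<psi>) - \<psi> = (sqrt g - (1 - \<psi>))\<^sup>2 / (1 - \<psi>)\<close> with \<open>g = K \<nu>\<close> expresses the duality gap as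
  a sum of two non-negative terms, which vanish exactly under the optimality conditions.

  Strong duality and dual attainment do not need a primal minimiser. Along a minimising sequence
  \<open>\<nu>\<^sub>n\<close> the functions \<open>K \<nu>\<^sub>n\<close> are bounded and equicontinuous, hence subconverge uniformly to some \<open>g\<close> by
  Arzela-Ascoli. Perturbing \<open>\<nu>\<^sub>n\<close> by \<open>t \<delta>\<^sub>y\<close> and letting \<open>n \<rightarrow> \<infinity>\<close>, then \<open>t \<rightarrow> 0\<close>, shows that \<open>1 - sqrt g\<close> is
  feasible; rescaling \<open>\<nu>\<^sub>n\<close> shows that the masses converge to \<open>\<integral> sqrt g d\<rho>\<close>, so that it attains the
  primal infimum. Fatou's lemma gives \<open>\<integral> g / (1 - \<psi>) d\<rho> \<le> \<integral> sqrt g d\<rho>\<close> for feasible \<open>\<psi>\<close>, and the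
  identity above then forces every dual maximiser to equal \<open>1 - sqrt g\<close> almost everywhere.
\<close>

section \<open>The kernel and the pointwise entropy inequality\<close>

definition cos_kernel :: "real \<Rightarrow> 'a::euclidean_space \<Rightarrow> 'a \<Rightarrow> real" where
  "cos_kernel \<kappa> x y = (trunc_cos (dist x y / \<kappa>))\<^sup>2"

definition kernel_transform :: "real \<Rightarrow> 'a::euclidean_space measure \<Rightarrow> 'a \<Rightarrow> real" where
  "kernel_transform \<kappa> \<nu> x = (LINT y|\<nu>. cos_kernel \<kappa> x y)"

lemma trunc_cos_nonneg: "0 \<le> trunc_cos s"
  unfolding trunc_cos_def by (rule cos_ge_zero) (auto simp: min_def)

lemma cos_kernel_nonneg [simp]: "0 \<le> cos_kernel \<kappa> x y"
  by (simp add: cos_kernel_def)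

lemma cos_kernel_le_1 [simp]: "cos_kernel \<kappa> x y \<le> 1"
  unfolding cos_kernel_def by (rule power_le_one) (auto simp: trunc_cos_nonneg, simp add: trunc_cos_def)

lemma continuous_on_cos_kernel:
  "0 < \<kappa> \<Longrightarrow> continuous_on UNIV (\<lambda>z. cos_kernel \<kappa> (fst z) (snd z))"
  unfolding cos_kernel_def trunc_cos_def by (intro continuous_intros) auto

lemma continuous_on_cos_kernel_left: "0 < \<kappa> \<Longrightarrow> continuous_on S (\<lambda>x. cos_kernel \<kappa> x y)"
  unfolding cos_kernel_def trunc_cos_def by (intro continuous_intros) auto

lemma borel_measurable_cos_kernel [measurable]:
  "(\<lambda>z. cos_kernel \<kappa> (fst z) (snd z)) \<in> borel_measurable (borel \<Otimes>\<^sub>M borel)"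
  unfolding cos_kernel_def trunc_cos_def by measurable

lemma borel_measurable_hk_cost [measurable]:
  "(\<lambda>z. hk_cost \<kappa> (fst z) (snd z)) \<in> borel_measurable (borel \<Otimes>\<^sub>M borel)"
  unfolding hk_cost_def by measurable

lemma borel_measurable_entropy_fun [measurable]: "entropy_fun \<in> borel_measurable borel"
  unfolding entropy_fun_def by measurable

lemma trunc_cos_pos_iff: "0 < trunc_cos s \<longleftrightarrow> \<bar>s\<bar> < pi / 2"
proof (cases "\<bar>s\<bar> < pi / 2")
  case True
  then show ?thesis using cos_gt_zero_pi[of "\<bar>s\<bar>"] pi_gt_zero
    by (simp add: trunc_cos_def min_def)
next
  case False
  then have "min \<bar>s\<bar> (pi / 2) = pi / 2" by simp
  then show ?thesis using False by (simp add: trunc_cos_def)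
qed

lemma cos_kernel_pos_iff: "0 < \<kappa> \<Longrightarrow> 0 < cos_kernel \<kappa> x y \<longleftrightarrow> dist x y < \<kappa> * pi / 2"
  using trunc_cos_pos_iff[of "dist x y / \<kappa>"] trunc_cos_nonneg[of "dist x y / \<kappa>"]
  by (simp add: cos_kernel_def field_simps less_le)

text \<open>The kernel vanishes exactly where the cost is infinite, so the cost is minus its
  logarithm with \<open>- ln 0\<close> read as infinite. This is the form in which the cost combines
  with the entropy.\<close>

lemma hk_cost_eq_ln:
  assumes "0 < \<kappa>"
  shows "hk_cost \<kappa> x y = (if 0 < cos_kernel \<kappa> x y then ennreal (- ln (cos_kernel \<kappa> x y)) else \<infinity>)"
proof (cases "dist x y < \<kappa> * pi / 2")
  case True
  then have d: "dist x y / \<kappa> < pi / 2" using assms by (simp add: field_simps)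
  then have "trunc_cos (dist x y / \<kappa>) = cos (dist x y / \<kappa>)" "0 < cos (dist x y / \<kappa>)"
    using assms cos_gt_zero_pi[of "dist x y / \<kappa>"] pi_gt_zero
    by (auto simp: trunc_cos_def min_def intro!: cos_gt_zero_pi less_le_trans[OF _ zero_le_dist]
         intro: less_le_trans[of _ 0])
  then show ?thesis using True cos_kernel_pos_iff[OF assms, of x y]
    by (simp add: hk_cost_def cos_kernel_def ln_realpow)
next
  case False
  then show ?thesis using cos_kernel_pos_iff[OF assms, of x y] by (simp add: hk_cost_def)
qed

lemma entropy_fun_nonneg: "0 \<le> (s::real) \<Longrightarrow> 0 \<le> s * ln s - s + 1"
proof (cases "s = 0")
  case False
  assume "0 \<le> s"
  with False have "0 < s" by simp
  then have "ln (1 / s) \<le> 1 / s - 1" by (intro ln_le_minus_one) auto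
  then have "s * - ln s \<le> s * (1 / s - 1)"
    using \<open>0 < s\<close> by (intro mult_left_mono) (auto simp: ln_div)
  then show ?thesis using \<open>0 < s\<close> by (simp add: algebra_simps)
qed simp

text \<open>At \<open>s = 0\<close> the formula also gives 1, because the factor \<open>s\<close>
  annihilates the logarithm, so one expression covers all non-negative arguments.\<close>

lemma entropy_fun_eq: "0 \<le> s \<Longrightarrow> entropy_fun s = ennreal (s * ln s - s + 1)"
  by (auto simp: entropy_fun_def)

text \<open>Non-negativity of the entropy at the ratio \<open>s / q\<close>, multiplied by
  \<open>q\<close>. Equality holds for \<open>s = q\<close>, which later dictates the optimal
  plan.\<close>

lemma ln_young_inequality:
  fixes s q :: real
  assumes "0 < s" "0 < q"
  shows "s * ln q + s \<le> s * ln s + q"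
proof -
  have "0 \<le> q * ((s / q) * ln (s / q) - s / q + 1)"
    using assms entropy_fun_nonneg[of "s / q"] by simp
  also have "\<dots> = s * ln s - s * ln q - s + q"
    using assms by (simp add: ln_div algebra_simps)
  finally show ?thesis by simp
qed

text \<open>The summand \<open>s * A\<close> only keeps both sides non-negative when \<open>ln t < 0\<close>.\<close>

lemma hk_cost_entropy_ge:
  assumes "0 < \<kappa>" "0 \<le> s" "0 < t" "0 \<le> A" "0 \<le> ln t + A"
  shows "1 + ennreal (s * (ln t + A)) \<le>
    ennreal s * hk_cost \<kappa> x y + entropy_fun s + ennreal (t * cos_kernel \<kappa> x y + s * A)"
proof -
  let ?k = "cos_kernel \<kappa> x y"
  consider "s = 0" | "0 < s" "\<not> 0 < ?k" | "0 < s" "0 < ?k" using assms by linarith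
  then show ?thesis
  proof cases
    case 1
    then show ?thesis using assms by (simp add: entropy_fun_def)
  next
    case 2
    then show ?thesis using assms by (simp add: hk_cost_eq_ln ennreal_mult_top)
  next
    case 3
    have l: "0 \<le> - ln ?k" using 3 by simp
    \<comment> \<open>Young's inequality with \<open>q = t * ?k\<close>: as the cost is
      \<open>- ln ?k\<close>, the term \<open>s * ln q\<close> splits into \<open>s * ln t\<close>
      minus \<open>s\<close> times the cost.\<close>
    have "s * ln (t * ?k) + s \<le> s * ln s + t * ?k"
      using 3 assms by (intro ln_young_inequality) auto
    then have *: "1 + s * (ln t + A) \<le> s * (- ln ?k) + (s * ln s - s + 1) + (t * ?k + s * A)"
      using 3 assms by (simp add: ln_mult algebra_simps)
    have "1 + ennreal (s * (ln t + A)) = ennreal (1 + s * (ln t + A))"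
      using assms by (simp add: ennreal_plus flip: ennreal_1)
    also have "\<dots> \<le> ennreal (s * (- ln ?k) + (s * ln s - s + 1) + (t * ?k + s * A))"
      using * by (rule ennreal_leI)
    also have "\<dots> = ennreal s * hk_cost \<kappa> x y + entropy_fun s + ennreal (t * ?k + s * A)"
    proof -
      have "0 \<le> s * (- ln ?k)" "0 \<le> s * ln s - s + 1" "0 \<le> t * ?k + s * A"
        using mult_nonneg_nonneg[OF assms(2) l] assms entropy_fun_nonneg[of s] by auto
      then show ?thesis
        using 3 assms l unfolding hk_cost_eq_ln[OF assms(1)] entropy_fun_eq[OF assms(2)]
        by (simp only: if_True ennreal_plus add_nonneg_nonneg ennreal_mult)
    qed
    finally show ?thesis .
  qed
qed

section \<open>Measurability and the kernel transform on Radon measures\<close>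

lemma radon_measuresD:
  assumes "\<nu> \<in> radon_measures S"
  shows "sets \<nu> = sets (restrict_space borel S)" "space \<nu> = S" "finite_measure \<nu>"
  using assms sets_eq_imp_space_eq[of \<nu> "restrict_space borel S"]
  by (auto simp: radon_measures_def space_restrict_space)

lemma borel_measurable_radon:
  assumes "\<nu> \<in> radon_measures S" "f \<in> borel_measurable borel"
  shows "f \<in> borel_measurable \<nu>"
  using measurable_restrict_space1[OF assms(2), of S]
  by (simp cong: measurable_cong_sets add: measurable_cong_sets[OF radon_measuresD(1)[OF assms(1)] refl])

lemma borel_measurable_radon_continuous:
  fixes f :: "'a::euclidean_space \<Rightarrow> 'b::topological_space"
  assumes "\<nu> \<in> radon_measures S" "continuous_on S f"
  shows "f \<in> borel_measurable \<nu>"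
  using borel_measurable_continuous_on_restrict[OF assms(2)]
  by (simp add: measurable_cong_sets[OF radon_measuresD(1)[OF assms(1)] refl])

lemma cos_kernel_measurable [measurable]: "cos_kernel \<kappa> x \<in> borel_measurable borel"
  unfolding cos_kernel_def trunc_cos_def by measurable

lemma integrable_cos_kernel:
  assumes "\<nu> \<in> radon_measures S"
  shows "integrable \<nu> (cos_kernel \<kappa> x)"
proof -
  interpret finite_measure \<nu> using assms by (rule radon_measuresD)
  show ?thesis
    by (rule integrable_const_bound[of _ 1]) (auto intro: borel_measurable_radon[OF assms])
qed

lemma nn_integral_cos_kernel:
  assumes "\<nu> \<in> radon_measures S"
  shows "(\<integral>\<^sup>+y. ennreal (cos_kernel \<kappa> x y) \<partial>\<nu>) = ennreal (kernel_transform \<kappa> \<nu> x)"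
  unfolding kernel_transform_def
  by (rule nn_integral_eq_integral) (auto intro: integrable_cos_kernel[OF assms])

lemma kernel_transform_nonneg [simp]: "0 \<le> kernel_transform \<kappa> \<nu> x"
  by (simp add: kernel_transform_def)

lemma kernel_transform_le_mass:
  assumes "\<nu> \<in> radon_measures S"
  shows "kernel_transform \<kappa> \<nu> x \<le> measure \<nu> S"
proof -
  interpret finite_measure \<nu> using assms by (rule radon_measuresD)
  have "kernel_transform \<kappa> \<nu> x \<le> (LINT y|\<nu>. 1)"
    unfolding kernel_transform_def by (intro integral_mono integrable_cos_kernel[OF assms]) auto
  then show ?thesis using radon_measuresD(2)[OF assms] by simp
qed

section \<open>The distance from a Dirac mass\<close>

text \<open>Against a Dirac mass only the value of the density at \<open>x\<close> matters, and
  integrating the density shows that this value is the total mass.\<close>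

lemma KL_return_eq:
  assumes "x \<in> space N" "finite_measure \<mu>" "sets \<mu> = sets N" "absolutely_continuous (return N x) \<mu>"
  shows "KL \<mu> (return N x) = entropy_fun (measure \<mu> (space \<mu>))"
proof -
  interpret r: prob_space "return N x" using assms(1) by (rule prob_space_return)
  interpret finite_measure \<mu> by fact
  let ?D = "RN_deriv (return N x) \<mu>"
  have sp: "space \<mu> = space N" using assms(3) by (rule sets_eq_imp_space_eq)
  have D [measurable]: "?D \<in> borel_measurable N"
    using borel_measurable_RN_deriv[of "return N x" \<mu>] by simp
  have "emeasure \<mu> (space \<mu>) = (\<integral>\<^sup>+y. 1 \<partial>\<mu>)" by simp
  also have "\<dots> = (\<integral>\<^sup>+y. ?D y * 1 \<partial>return N x)"
    using assms by (intro r.RN_deriv_nn_integral) auto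
  also have "\<dots> = ?D x"
    using assms(1) by (subst nn_integral_return) auto
  finally have "enn2real (?D x) = measure \<mu> (space \<mu>)" by (simp add: measure_def)
  then show ?thesis
    using assms by (simp add: KL_def nn_integral_return)
qed

text \<open>The complement of \<open>{x}\<close> is null for the Dirac mass, hence for the image
  measure. Applied to \<open>fst\<close>, it confines every plan of finite value to the fibre over
  \<open>x\<close>.\<close>

lemma AE_eq_of_absolutely_continuous_return:
  assumes "x \<in> space N" "{x} \<in> sets N" "f \<in> measurable \<gamma> N"
    "absolutely_continuous (return N x) (distr \<gamma> N f)"
  shows "AE z in \<gamma>. f z = x"
proof -
  have "{y \<in> space N. y = x} = {x}" using assms(1) by auto
  then have set: "{y \<in> space N. y = x} \<in> sets N" using assms(2) by simp
  have "AE y in return N x. y = x" using AE_return[of x N "\<lambda>y. y = x"] assms(1) set by (simp only: pred_def)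
  moreover have "sets (distr \<gamma> N f) = sets (return N x)" by simp
  ultimately have "AE y in distr \<gamma> N f. y = x"
    using assms(4) by (metis absolutely_continuous_AE)
  then show ?thesis using AE_distr_iff[OF assms(3) set] by simp
qed

text \<open>Weak duality for the transport problem, with the single dual parameter \<open>t\<close>.
  Integrating \<open>hk_cost_entropy_ge\<close> handles the cost and the second marginal; the first
  marginal enters only through its mass. The term in \<open>t\<close> stands on the right because
  subtraction in \<open>ennreal\<close> truncates.\<close>

lemma HK2_return_ge:
  fixes \<Omega> :: "'a::euclidean_space set"
  assumes \<kappa>: "0 < \<kappa>" and \<nu>: "\<nu> \<in> radon_measures \<Omega>" and x: "x \<in> \<Omega>" and t: "0 < t"
  shows "ennreal (1 + measure \<nu> \<Omega>) \<le>
    HK2 \<Omega> \<kappa> (return (restrict_space borel \<Omega>) x) \<nu> + ennreal (t * kernel_transform \<kappa> \<nu> x + 1 / t)"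
    (is "?L \<le> _ + ?c")
proof -
  let ?N = "restrict_space borel \<Omega> :: 'a measure"
  have sN: "space ?N = \<Omega>" by (simp add: space_restrict_space)
  interpret nu: finite_measure \<nu> using \<nu> by (rule radon_measuresD)
  have plan: "?L \<le> ?c + ((\<integral>\<^sup>+z. hk_cost \<kappa> (fst z) (snd z) \<partial>\<gamma>)
      + KL (distr \<gamma> ?N fst) (return ?N x) + KL (distr \<gamma> ?N snd) \<nu>)"
    if \<gamma>: "\<gamma> \<in> radon_measures (\<Omega> \<times> \<Omega>)" for \<gamma> :: "('a \<times> 'a) measure"
  proof (cases "absolutely_continuous (return ?N x) (distr \<gamma> ?N fst) \<and> absolutely_continuous \<nu> (distr \<gamma> ?N snd)")
    case False
    then show ?thesis by (auto simp: KL_def)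
  next
    case True
    interpret g: finite_measure \<gamma> using \<gamma> by (rule radon_measuresD)
    have sg: "space \<gamma> = \<Omega> \<times> \<Omega>" using \<gamma> by (rule radon_measuresD)
    have fst: "fst \<in> measurable \<gamma> ?N" and snd: "snd \<in> measurable \<gamma> ?N"
      by (auto intro!: measurable_restrict_space2 borel_measurable_radon[OF \<gamma>]
          borel_measurable_continuous_onI continuous_on_fst continuous_on_snd continuous_on_id simp: sg)
    define m where "m = measure \<gamma> (\<Omega> \<times> \<Omega>)"
    define s where "s = (\<lambda>y. enn2real (RN_deriv \<nu> (distr \<gamma> ?N snd) y))"
    \<comment> \<open>\<open>A\<close> makes \<open>ln t + A\<close> non-negative. The finite
      quantity \<open>m * A\<close> is carried on both sides and cancelled at the end.\<close>
    define A where "A = \<bar>ln t\<bar>"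
    interpret d1: finite_measure "distr \<gamma> ?N fst" by (rule g.finite_measure_distr[OF fst])
    interpret d2: finite_measure "distr \<gamma> ?N snd" by (rule g.finite_measure_distr[OF snd])
    have sets\<nu>: "sets \<nu> = sets ?N" using \<nu> by (rule radon_measuresD)
    have sp\<nu>: "space \<nu> = \<Omega>" using \<nu> by (rule radon_measuresD)
    have s_meas [measurable]: "s \<in> borel_measurable \<nu>" unfolding s_def by measurable
    have hk_meas [measurable]: "hk_cost \<kappa> x \<in> borel_measurable \<nu>"
      by (rule borel_measurable_radon[OF \<nu>]) (simp add: hk_cost_def[abs_def])
    have k_meas [measurable]: "cos_kernel \<kappa> x \<in> borel_measurable \<nu>"
      by (rule borel_measurable_radon[OF \<nu>]) measurable
    have m_fst: "measure (distr \<gamma> ?N fst) (space (distr \<gamma> ?N fst)) = m"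
    proof -
      have "fst -` \<Omega> \<inter> space \<gamma> = \<Omega> \<times> \<Omega>" by (auto simp: sg)
      then show ?thesis using measure_distr[OF fst sets.top] by (simp add: m_def sN)
    qed
    have KL1: "KL (distr \<gamma> ?N fst) (return ?N x) = entropy_fun m"
      unfolding m_fst[symmetric]
      using True x by (intro KL_return_eq) (simp_all add: sN d1.finite_measure_axioms)
    have RN_s: "AE y in \<nu>. RN_deriv \<nu> (distr \<gamma> ?N snd) y = ennreal (s y)"
      using nu.RN_deriv_finite[of "distr \<gamma> ?N snd"] True sets\<nu> d2.sigma_finite_measure_axioms
      by (auto simp: s_def less_top)
    have s_int: "(\<integral>\<^sup>+y. ennreal (s y) * f y \<partial>\<nu>) = (\<integral>\<^sup>+z. f (snd z) \<partial>\<gamma>)"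
      if f: "f \<in> borel_measurable \<nu>" for f
    proof -
      have "(\<integral>\<^sup>+y. ennreal (s y) * f y \<partial>\<nu>) = (\<integral>\<^sup>+y. RN_deriv \<nu> (distr \<gamma> ?N snd) y * f y \<partial>\<nu>)"
        using RN_s by (intro nn_integral_cong_AE) auto
      also have "\<dots> = integral\<^sup>N (distr \<gamma> ?N snd) f"
        using True sets\<nu> f by (intro nu.RN_deriv_nn_integral[symmetric]) auto
      also have "\<dots> = (\<integral>\<^sup>+z. f (snd z) \<partial>\<gamma>)"
        using f snd sets\<nu> by (intro nn_integral_distr) (auto cong: measurable_cong_sets)
      finally show ?thesis .
    qed
    have mass: "(\<integral>\<^sup>+y. ennreal (s y) \<partial>\<nu>) = ennreal m"
      using s_int[of "\<lambda>_. 1"] by (simp add: m_def g.emeasure_eq_measure sg)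
    have "{x} \<in> sets ?N"
      unfolding sets_restrict_space using x by (intro image_eqI[of _ _ "{x}"]) auto
    then have "AE z in \<gamma>. fst z = x"
      by (intro AE_eq_of_absolutely_continuous_return[of x ?N]) (simp_all only: sN x fst True)
    \<comment> \<open>The plan sits over \<open>x\<close>, so its cost depends on the second
      coordinate only and can be written with the density \<open>s\<close> of the second
      marginal.\<close>
    then have cost: "(\<integral>\<^sup>+z. hk_cost \<kappa> (fst z) (snd z) \<partial>\<gamma>) = (\<integral>\<^sup>+y. ennreal (s y) * hk_cost \<kappa> x y \<partial>\<nu>)"
      by (subst s_int) (auto intro!: nn_integral_cong_AE)
    have KL2: "KL (distr \<gamma> ?N snd) \<nu> = (\<integral>\<^sup>+y. entropy_fun (s y) \<partial>\<nu>)"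
      using True by (simp add: KL_def s_def)
    have s0: "0 \<le> s y" for y by (simp add: s_def)
    have A: "0 \<le> A" "0 \<le> ln t + A" by (auto simp: A_def)
    have m0: "0 \<le> m" by (simp add: m_def)
    let ?K = "kernel_transform \<kappa> \<nu> x"
    let ?C = "\<integral>\<^sup>+z. hk_cost \<kappa> (fst z) (snd z) \<partial>\<gamma>"
    have "ennreal (measure \<nu> \<Omega>) + ennreal m * ennreal (ln t + A) = (\<integral>\<^sup>+y. 1 + ennreal (s y * (ln t + A)) \<partial>\<nu>)"
      using A s0 mass by (subst nn_integral_add)
        (auto simp: nn_integral_multc ennreal_mult nu.emeasure_eq_measure sp\<nu>)
    also have "\<dots> \<le> (\<integral>\<^sup>+y. ennreal (s y) * hk_cost \<kappa> x y + entropy_fun (s y)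
        + ennreal (t * cos_kernel \<kappa> x y + s y * A) \<partial>\<nu>)"
      by (intro nn_integral_mono hk_cost_entropy_ge \<kappa> s0 t A)
    also have "\<dots> = ?C + KL (distr \<gamma> ?N snd) \<nu> + (ennreal t * ennreal ?K + ennreal m * ennreal A)"
      using A t s0 by (simp add: nn_integral_add ennreal_mult nn_integral_cmult nn_integral_multc
        nn_integral_cos_kernel[OF \<nu>] mass cost KL2)
    finally have 1: "ennreal (measure \<nu> \<Omega>) + ennreal (m * (ln t + A)) \<le>
      ?C + KL (distr \<gamma> ?N snd) \<nu> + (ennreal (t * ?K) + ennreal (m * A))"
      using A t m0 by (simp add: ennreal_mult)
    \<comment> \<open>Young's inequality for the first marginal, with \<open>q = 1 / t\<close>; this
      is the source of the summand \<open>1 / t\<close> in \<open>?c\<close>.\<close>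
    have "m * ln (1 / t) + m \<le> m * ln m + 1 / t"
      using t m0 by (cases "m = 0") (auto intro!: ln_young_inequality)
    then have "1 \<le> m * ln m - m + 1 + 1 / t + m * ln t"
      using t by (simp add: ln_div algebra_simps)
    then have "ennreal (1 + m * A) \<le> ennreal (m * ln m - m + 1 + 1 / t + m * (ln t + A))"
      by (intro ennreal_leI) (simp add: algebra_simps)
    then have 2: "ennreal (1 + m * A) \<le> entropy_fun m + ennreal (1 / t) + ennreal (m * (ln t + A))"
      using entropy_fun_nonneg[OF m0] m0 A t
      unfolding entropy_fun_eq[OF m0]
      by (simp flip: ennreal_plus)
    have "?L + ennreal (m * A) = ennreal (measure \<nu> \<Omega>) + ennreal (1 + m * A)"
      using m0 A by (simp flip: ennreal_plus)
    also have "\<dots> \<le> ennreal (measure \<nu> \<Omega>) + (entropy_fun m + ennreal (1 / t) + ennreal (m * (ln t + A)))"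
      using 2 by (rule add_left_mono)
    also have "\<dots> = (ennreal (measure \<nu> \<Omega>) + ennreal (m * (ln t + A))) + (entropy_fun m + ennreal (1 / t))"
      by (simp add: ac_simps)
    also have "\<dots> \<le> ?C + KL (distr \<gamma> ?N snd) \<nu> + (ennreal (t * ?K) + ennreal (m * A)) + (entropy_fun m + ennreal (1 / t))"
      using 1 by (rule add_right_mono)
    also have "\<dots> = ?c + (?C + entropy_fun m + KL (distr \<gamma> ?N snd) \<nu>) + ennreal (m * A)"
      using t by (simp add: ennreal_plus ac_simps)
    finally have "?L \<le> ?c + (?C + entropy_fun m + KL (distr \<gamma> ?N snd) \<nu>)"
      
      unfolding add.commute[of _ "ennreal (m * A)"] by (simp add: ennreal_add_left_cancel_le)
    then show ?thesis by (simp add: KL1)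
  qed
  have "?L - ?c \<le> HK2 \<Omega> \<kappa> (return ?N x) \<nu>"
    unfolding HK2_def
    by (intro INF_greatest) (use plan in \<open>auto simp: ennreal_minus_le_iff\<close>)
  then show ?thesis by (auto simp: ennreal_minus_le_iff add.commute)
qed

text \<open>The equality case of Young's inequality: the density
  \<open>t * cos_kernel \<kappa> x y\<close> is the critical one. Where the kernel vanishes so does
  the density, and zero times infinity is zero in \<open>ennreal\<close>, so the infinite cost does
  no harm.\<close>

lemma hk_cost_entropy_eq:
  fixes x y :: "'a::euclidean_space" and \<kappa> t :: real
  assumes "0 < \<kappa>" "0 < t"
  defines "s \<equiv> t * cos_kernel \<kappa> x y"
  shows "0 \<le> 1 + s * (ln t - 1)"
    and "ennreal s * hk_cost \<kappa> x y + entropy_fun s = ennreal (1 + s * (ln t - 1))"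
proof -
  let ?k = "cos_kernel \<kappa> x y"
  have "0 \<le> 1 + s * (ln t - 1) \<and>
    ennreal s * hk_cost \<kappa> x y + entropy_fun s = ennreal (1 + s * (ln t - 1))"
  proof (cases "0 < ?k")
    case False
    then have "?k = 0" using cos_kernel_nonneg[of \<kappa> x y] by linarith
    then show ?thesis by (simp add: s_def entropy_fun_def)
  next
    case True
    have s: "0 < s" using True assms by (simp add: s_def)
    have l: "0 \<le> s * (- ln ?k)" using True s by (intro mult_nonneg_nonneg) auto
    have e: "0 \<le> s * ln s - s + 1" using s entropy_fun_nonneg[of s] by simp
    have eq: "s * (- ln ?k) + (s * ln s - s + 1) = 1 + s * (ln t - 1)"
      using True assms by (simp add: s_def ln_mult algebra_simps)
    have "ennreal s * hk_cost \<kappa> x y + entropy_fun s = ennreal (s * (- ln ?k)) + ennreal (s * ln s - s + 1)"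
      using True s assms by (simp add: hk_cost_eq_ln entropy_fun_eq flip: ennreal_mult)
    also have "\<dots> = ennreal (1 + s * (ln t - 1))"
      using l e by (simp only: eq flip: ennreal_plus)
    finally show ?thesis using l e eq by linarith
  qed
  then show "0 \<le> 1 + s * (ln t - 1)"
    and "ennreal s * hk_cost \<kappa> x y + entropy_fun s = ennreal (1 + s * (ln t - 1))" by auto
qed

text \<open>The competitor is \<nu> with density \<open>t * cos_kernel \<kappa> x\<close>,
  transported onto the fibre over \<open>x\<close>. Its first marginal is a Dirac mass of weight
  \<open>m\<close>, whose entropy is the last bracket; the rest is the integrated equality
  \<open>hk_cost_entropy_eq\<close>.\<close>

lemma HK2_return_le_plan:
  fixes \<Omega> :: "'a::euclidean_space set"
  assumes \<kappa>: "0 < \<kappa>" and \<nu>: "\<nu> \<in> radon_measures \<Omega>" and x: "x \<in> \<Omega>" and t: "0 < t"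
  defines "m \<equiv> t * kernel_transform \<kappa> \<nu> x"
  shows "HK2 \<Omega> \<kappa> (return (restrict_space borel \<Omega>) x) \<nu> \<le>
    ennreal (measure \<nu> \<Omega> + m * (ln t - 1) + (m * ln m - m + 1))"
proof -
  let ?N = "restrict_space borel \<Omega> :: 'a measure"
  let ?NN = "restrict_space borel (\<Omega> \<times> \<Omega>) :: ('a \<times> 'a) measure"
  have sN: "space ?N = \<Omega>" by (simp add: space_restrict_space)
  have sets\<nu>: "sets \<nu> = sets ?N" using \<nu> by (rule radon_measuresD)
  have sp\<nu>: "space \<nu> = \<Omega>" using \<nu> by (rule radon_measuresD)
  interpret nu: finite_measure \<nu> using \<nu> by (rule radon_measuresD)
  define s where "s = (\<lambda>y. t * cos_kernel \<kappa> x y)"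
  define \<eta> where "\<eta> = density \<nu> (\<lambda>y. ennreal (s y))"
  define \<gamma> where "\<gamma> = distr \<eta> ?NN (\<lambda>y. (x, y))"
  have s0: "0 \<le> s y" for y using t by (simp add: s_def)
  have s_borel [measurable]: "s \<in> borel_measurable borel" unfolding s_def by measurable
  have s_meas [measurable]: "s \<in> borel_measurable \<nu>" by (rule borel_measurable_radon[OF \<nu>]) measurable
  have hk_meas [measurable]: "hk_cost \<kappa> x \<in> borel_measurable \<nu>"
    by (rule borel_measurable_radon[OF \<nu>]) (simp add: hk_cost_def[abs_def])
  have sets\<eta>: "sets \<eta> = sets ?N" by (simp add: \<eta>_def sets\<nu>)
  have sp\<eta>: "space \<eta> = \<Omega>" by (simp add: \<eta>_def sp\<nu>)
  have mass: "emeasure \<eta> \<Omega> = ennreal m"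
  proof -
    have "emeasure \<eta> \<Omega> = (\<integral>\<^sup>+y. ennreal (s y) * indicator (space \<nu>) y \<partial>\<nu>)"
      using emeasure_density[of "\<lambda>y. ennreal (s y)" \<nu> \<Omega>] sets.top[of \<nu>] by (simp add: \<eta>_def sp\<nu>)
    also have "\<dots> = (\<integral>\<^sup>+y. ennreal t * ennreal (cos_kernel \<kappa> x y) \<partial>\<nu>)"
      using t by (intro nn_integral_cong) (auto simp: s_def ennreal_mult)
    also have "\<dots> = ennreal t * ennreal (kernel_transform \<kappa> \<nu> x)"
      by (subst nn_integral_cmult) (auto intro: borel_measurable_radon[OF \<nu>] simp: nn_integral_cos_kernel[OF \<nu>])
    finally show ?thesis using t by (simp add: m_def ennreal_mult)
  qed
  have m0: "0 \<le> m" using t by (simp add: m_def)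
  interpret e: finite_measure \<eta> by standard (simp add: sp\<eta> mass)
  have pair: "(\<lambda>y. (x, y)) \<in> measurable \<eta> ?NN"
  proof (rule measurable_restrict_space2)
    show "(\<lambda>y. (x, y)) \<in> space \<eta> \<rightarrow> \<Omega> \<times> \<Omega>" using x by (auto simp: sp\<eta>)
    have "(\<lambda>y. (x, y)) \<in> borel_measurable (borel :: 'a measure)"
      by (intro borel_measurable_continuous_onI continuous_intros)
    then have "(\<lambda>y. (x, y)) \<in> borel_measurable ?N" by (rule measurable_restrict_space1)
    then show "(\<lambda>y. (x, y)) \<in> borel_measurable \<eta>" by (simp add: measurable_cong_sets[OF sets\<eta> refl])
  qed
  have fst: "fst \<in> measurable ?NN ?N" and snd: "snd \<in> measurable ?NN ?N"
    by (rule measurable_restrict_space2[OF _ measurable_restrict_space1];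
        auto intro!: borel_measurable_continuous_onI continuous_on_fst continuous_on_snd continuous_on_id
          simp: space_restrict_space)+
  have \<gamma>: "\<gamma> \<in> radon_measures (\<Omega> \<times> \<Omega>)"
    using e.finite_measure_distr[OF pair] by (simp add: radon_measures_def \<gamma>_def)
  have P1: "distr \<gamma> ?N fst = distr \<eta> ?N (\<lambda>_. x)"
    unfolding \<gamma>_def by (subst distr_distr[OF fst pair]) (simp add: comp_def)
  have P2: "distr \<gamma> ?N snd = \<eta>"
    unfolding \<gamma>_def by (subst distr_distr[OF snd pair]) (simp add: comp_def distr_id2 sets\<eta>)
  have cx: "(\<lambda>_. x) \<in> measurable \<eta> ?N" using x by (simp add: sN)
  have ac1: "absolutely_continuous (return ?N x) (distr \<eta> ?N (\<lambda>_. x))"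
    unfolding absolutely_continuous_def
  proof
    fix A assume A: "A \<in> null_sets (return ?N x)"
    then have AN: "A \<in> sets ?N" "x \<notin> A" by (auto simp: null_sets_def)
    then have "(\<lambda>_. x) -` A = ({} :: 'a set)" by auto
    then show "A \<in> null_sets (distr \<eta> ?N (\<lambda>_. x))"
      using AN emeasure_distr[OF cx AN(1)] by (simp add: null_sets_def)
  qed
  have "emeasure (distr \<eta> ?N (\<lambda>_. x)) \<Omega> = ennreal m"
    using x emeasure_distr[OF cx sets.top] by (simp add: sN mass sp\<eta>)
  then have m1: "measure (distr \<eta> ?N (\<lambda>_. x)) (space (distr \<eta> ?N (\<lambda>_. x))) = m"
    using m0 by (simp add: sN measure_def)
  have KL1: "KL (distr \<gamma> ?N fst) (return ?N x) = ennreal (m * ln m - m + 1)"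
    unfolding P1 entropy_fun_eq[OF m0, symmetric]
    unfolding m1[symmetric]
    using x ac1 e.finite_measure_distr[OF cx] by (intro KL_return_eq) (simp_all add: sN)
  have ac2: "absolutely_continuous \<nu> \<eta>"
    unfolding \<eta>_def by (rule absolutely_continuousI_density) measurable
  have "AE y in \<nu>. ennreal (s y) = RN_deriv \<nu> \<eta> y"
    by (rule nu.RN_deriv_unique) (auto simp: \<eta>_def)
  then have KL2: "KL (distr \<gamma> ?N snd) \<nu> = (\<integral>\<^sup>+y. entropy_fun (s y) \<partial>\<nu>)"
    unfolding P2 KL_def if_P[OF ac2]
    by (intro nn_integral_cong_AE, eventually_elim) (metis enn2real_ennreal s0)
  have "(\<lambda>z. hk_cost \<kappa> (fst z) (snd z)) \<in> borel_measurable ?NN"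
    by (rule measurable_restrict_space1)
      (use borel_measurable_hk_cost[of \<kappa>] in \<open>simp add: borel_prod\<close>)
  then have cost: "(\<integral>\<^sup>+z. hk_cost \<kappa> (fst z) (snd z) \<partial>\<gamma>) = (\<integral>\<^sup>+y. ennreal (s y) * hk_cost \<kappa> x y \<partial>\<nu>)"
    unfolding \<gamma>_def by (subst nn_integral_distr[OF pair]) (auto simp: \<eta>_def nn_integral_density)
  have int: "integrable \<nu> (\<lambda>y. 1 + s y * (ln t - 1))"
    unfolding s_def using integrable_cos_kernel[OF \<nu>] by (intro Bochner_Integration.integrable_add) auto
  have nn: "0 \<le> 1 + s y * (ln t - 1)" for y
    unfolding s_def by (rule hk_cost_entropy_eq(1)[OF \<kappa> t])
  have val: "(LINT y|\<nu>. 1 + s y * (ln t - 1)) = measure \<nu> \<Omega> + m * (ln t - 1)"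
    using integrable_cos_kernel[OF \<nu>, of \<kappa> x]
    by (simp add: s_def m_def kernel_transform_def sp\<nu>)
  have "(\<integral>\<^sup>+z. hk_cost \<kappa> (fst z) (snd z) \<partial>\<gamma>) + KL (distr \<gamma> ?N snd) \<nu> =
      (\<integral>\<^sup>+y. ennreal (s y) * hk_cost \<kappa> x y + entropy_fun (s y) \<partial>\<nu>)"
    unfolding cost KL2 by (subst nn_integral_add) auto
  also have "\<dots> = (\<integral>\<^sup>+y. ennreal (1 + s y * (ln t - 1)) \<partial>\<nu>)"
    unfolding s_def by (simp only: hk_cost_entropy_eq(2)[OF \<kappa> t])
  also have "\<dots> = ennreal (measure \<nu> \<Omega> + m * (ln t - 1))"
    unfolding val[symmetric] using int nn by (intro nn_integral_eq_integral) auto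
  finally have sum: "(\<integral>\<^sup>+z. hk_cost \<kappa> (fst z) (snd z) \<partial>\<gamma>) + KL (distr \<gamma> ?N snd) \<nu> =
    ennreal (measure \<nu> \<Omega> + m * (ln t - 1))" .
  have "0 \<le> measure \<nu> \<Omega> + m * (ln t - 1)"
    unfolding val[symmetric] using nn by (intro integral_nonneg_AE) auto
  then have "((\<integral>\<^sup>+z. hk_cost \<kappa> (fst z) (snd z) \<partial>\<gamma>) + KL (distr \<gamma> ?N snd) \<nu>) + KL (distr \<gamma> ?N fst) (return ?N x)
      = ennreal (measure \<nu> \<Omega> + m * (ln t - 1) + (m * ln m - m + 1))"
    unfolding sum KL1 using entropy_fun_nonneg[OF m0] by (rule ennreal_plus[symmetric])
  then show ?thesis
    unfolding HK2_def by (intro INF_lower2[OF \<gamma>]) (simp add: ac_simps)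
qed

text \<open>The two bounds meet at \<open>t = 1 / sqrt K\<close>, the minimiser of
  \<open>t * K + 1 / t\<close>. For \<open>K = 0\<close> there is no minimiser: the lower bound is
  obtained as \<open>t\<close> tends to infinity, while \<open>t = 1\<close> suffices for the upper
  one.\<close>

lemma HK2_return_eq:
  fixes \<Omega> :: "'a::euclidean_space set"
  assumes \<kappa>: "0 < \<kappa>" and \<nu>: "\<nu> \<in> radon_measures \<Omega>" and x: "x \<in> \<Omega>"
  shows "HK2 \<Omega> \<kappa> (return (restrict_space borel \<Omega>) x) \<nu> =
    ennreal (1 + measure \<nu> \<Omega> - 2 * sqrt (kernel_transform \<kappa> \<nu> x))"
    (is "?H = _")
proof -
  define K where "K = kernel_transform \<kappa> \<nu> x"
  define M where "M = measure \<nu> \<Omega>"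
  have K0: "0 \<le> K" and M0: "0 \<le> M" by (auto simp: K_def M_def)
  have lower: "ennreal (1 + M - (t * K + 1 / t)) \<le> ?H" if "0 < t" for t
    using HK2_return_ge[OF assms that] that K0
    unfolding M_def[symmetric] K_def[symmetric]
    by (subst ennreal_minus[symmetric]) (auto simp: ennreal_minus_le_iff add.commute)
  have upper: "?H \<le> ennreal (M + t * K * (ln t - 1) + (t * K * ln (t * K) - t * K + 1))" if "0 < t" for t
    using HK2_return_le_plan[OF assms that] unfolding M_def K_def .
  show ?thesis
  proof (cases "K = 0")
    case True
    have "((\<lambda>t. ennreal (1 + M - 1 / t)) \<longlongrightarrow> ennreal (1 + M - 0)) at_top"
      by (intro tendsto_ennrealI tendsto_diff tendsto_const tendsto_divide_0[OF tendsto_const]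
          filterlim_at_top_imp_at_infinity filterlim_ident)
    moreover have "\<forall>\<^sub>F t in at_top. ennreal (1 + M - 1 / t) \<le> ?H"
      using eventually_gt_at_top[of "0::real"] by eventually_elim (use lower True in auto)
    ultimately have "ennreal (1 + M) \<le> ?H"
      by (intro tendsto_upperbound[of _ _ at_top]) auto
    then show ?thesis using upper[of 1] True by (auto simp: K_def M_def add.commute)
  next
    case False
    then have K: "0 < K" using K0 by simp
    have sq: "1 / sqrt K * K = sqrt K" using K by (simp add: real_div_sqrt)
    \<comment> \<open>For this \<open>t\<close> the plan has mass \<open>sqrt K\<close>, so the
      logarithms of \<open>t\<close> and of the mass cancel in the upper bound.\<close>
    have "ln (1 / sqrt K) + ln (sqrt K) = 0" using K by (simp add: ln_div)
    then have ln: "ln (sqrt K) = - ln (1 / sqrt K)" by simp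
    have "M + 1 / sqrt K * K * (ln (1 / sqrt K) - 1) + (1 / sqrt K * K * ln (1 / sqrt K * K) - 1 / sqrt K * K + 1)
       = 1 + M - 2 * sqrt K"
      unfolding sq ln by (simp add: algebra_simps)
    with upper[of "1 / sqrt K"] have "?H \<le> ennreal (1 + M - 2 * sqrt K)"
      by (simp only: zero_less_divide_1_iff real_sqrt_gt_0_iff K)
    moreover have "1 + M - (1 / sqrt K * K + 1 / (1 / sqrt K)) = 1 + M - 2 * sqrt K"
      unfolding sq by simp
    then have "ennreal (1 + M - 2 * sqrt K) \<le> ?H" using lower[of "1 / sqrt K"] K by simp
    ultimately show ?thesis by (simp add: K_def M_def)
  qed
qed

section \<open>Equicontinuity of kernel transforms\<close>

lemma cos_kernel_uniformly_continuous:
  fixes \<Omega> :: "'a::euclidean_space set"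
  assumes "compact \<Omega>" "0 < \<kappa>" "0 < e"
  obtains d where "0 < d"
    "\<And>x x' y. \<lbrakk>x \<in> \<Omega>; x' \<in> \<Omega>; y \<in> \<Omega>; dist x x' < d\<rbrakk> \<Longrightarrow> \<bar>cos_kernel \<kappa> x y - cos_kernel \<kappa> x' y\<bar> \<le> e"
proof -
  have "uniformly_continuous_on (\<Omega> \<times> \<Omega>) (\<lambda>z. cos_kernel \<kappa> (fst z) (snd z))"
    using assms by (intro compact_uniformly_continuous compact_Times
        continuous_on_subset[OF continuous_on_cos_kernel]) auto
  then obtain d where d: "0 < d" "\<And>z z'. \<lbrakk>z \<in> \<Omega> \<times> \<Omega>; z' \<in> \<Omega> \<times> \<Omega>; dist z' z < d\<rbrakk> \<Longrightarrow>
      dist (cos_kernel \<kappa> (fst z') (snd z')) (cos_kernel \<kappa> (fst z) (snd z)) < e"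
    using \<open>0 < e\<close> unfolding uniformly_continuous_on_def by metis
  show ?thesis
  proof
    show "\<bar>cos_kernel \<kappa> x y - cos_kernel \<kappa> x' y\<bar> \<le> e"
      if "x \<in> \<Omega>" "x' \<in> \<Omega>" "y \<in> \<Omega>" "dist x x' < d" for x x' y
      using d(2)[of "(x', y)" "(x, y)"] that by (simp add: dist_Pair_Pair dist_real_def)
  qed fact
qed

text \<open>The modulus of continuity of the kernel is uniform in its second argument, so it passes
  under the integral. Because \<open>d\<close> is chosen before \<nu>, families of bounded mass are
  equicontinuous, as Arzela-Ascoli requires.\<close>

lemma kernel_transform_equicontinuous:
  assumes "compact \<Omega>" "0 < \<kappa>" "0 < e"
  obtains d where "0 < d"
    "\<And>\<nu> x x'. \<lbrakk>\<nu> \<in> radon_measures \<Omega>; x \<in> \<Omega>; x' \<in> \<Omega>; dist x x' < d\<rbrakk> \<Longrightarrow>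
      \<bar>kernel_transform \<kappa> \<nu> x - kernel_transform \<kappa> \<nu> x'\<bar> \<le> e * measure \<nu> \<Omega>"
proof -
  obtain d where d: "0 < d"
    "\<And>x x' y. \<lbrakk>x \<in> \<Omega>; x' \<in> \<Omega>; y \<in> \<Omega>; dist x x' < d\<rbrakk> \<Longrightarrow> \<bar>cos_kernel \<kappa> x y - cos_kernel \<kappa> x' y\<bar> \<le> e"
    using cos_kernel_uniformly_continuous[OF assms] by metis
  show ?thesis
  proof
    fix \<nu> x x' assume *: "\<nu> \<in> radon_measures \<Omega>" "x \<in> \<Omega>" "x' \<in> \<Omega>" "dist x x' < d"
    interpret finite_measure \<nu> using *(1) by (rule radon_measuresD)
    have sp: "space \<nu> = \<Omega>" using *(1) by (rule radon_measuresD)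
    note int = integrable_cos_kernel[OF *(1)]
    have "\<bar>kernel_transform \<kappa> \<nu> x - kernel_transform \<kappa> \<nu> x'\<bar> =
        \<bar>LINT y|\<nu>. cos_kernel \<kappa> x y - cos_kernel \<kappa> x' y\<bar>"
      unfolding kernel_transform_def by (subst Bochner_Integration.integral_diff[OF int int]) simp
    also have "\<dots> \<le> (LINT y|\<nu>. \<bar>cos_kernel \<kappa> x y - cos_kernel \<kappa> x' y\<bar>)"
      by (rule integral_abs_bound)
    also have "\<dots> \<le> (LINT y|\<nu>. e)"
      using d(2)[of x x'] * int by (intro integral_mono Bochner_Integration.integrable_abs
        Bochner_Integration.integrable_diff) (auto simp: sp)
    finally show "\<bar>kernel_transform \<kappa> \<nu> x - kernel_transform \<kappa> \<nu> x'\<bar> \<le> e * measure \<nu> \<Omega>"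
      by (simp add: sp mult.commute)
  qed fact
qed

lemma continuous_on_kernel_transform:
  assumes "compact \<Omega>" "0 < \<kappa>" "\<nu> \<in> radon_measures \<Omega>"
  shows "continuous_on \<Omega> (kernel_transform \<kappa> \<nu>)"
  unfolding continuous_on_iff
proof (intro ballI allI impI)
  fix x and e :: real assume "x \<in> \<Omega>" "0 < e"
  \<comment> \<open>The added 1 allows division by \<open>M\<close> even for zero mass and makes the
    final estimate strict.\<close>
  define M where "M = measure \<nu> \<Omega> + 1"
  have M: "0 < M" by (simp add: M_def add_nonneg_pos)
  obtain d where d: "0 < d"
    "\<And>\<nu> x x'. \<lbrakk>\<nu> \<in> radon_measures \<Omega>; x \<in> \<Omega>; x' \<in> \<Omega>; dist x x' < d\<rbrakk> \<Longrightarrow>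
      \<bar>kernel_transform \<kappa> \<nu> x - kernel_transform \<kappa> \<nu> x'\<bar> \<le> (e / M) * measure \<nu> \<Omega>"
    using kernel_transform_equicontinuous[OF assms(1,2), of "e / M"] M \<open>0 < e\<close>
    by (metis divide_pos_pos)
  have "e / M * measure \<nu> \<Omega> < e / M * M"
    using M \<open>0 < e\<close> by (intro mult_strict_left_mono) (auto simp: M_def)
  then have lt: "e / M * measure \<nu> \<Omega> < e" using M by simp
  show "\<exists>d>0. \<forall>x'\<in>\<Omega>. dist x' x < d \<longrightarrow> dist (kernel_transform \<kappa> \<nu> x') (kernel_transform \<kappa> \<nu> x) < e"
    using d(2)[OF assms(3) _ \<open>x \<in> \<Omega>\<close>] d(1) lt unfolding dist_real_def by (meson le_less_trans)
qed

text \<open>The non-negative function \<open>1 - f\<close> has zero integral; finiteness of the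
  measure legitimises the subtraction. It yields complementary slackness for the dual
  constraint.\<close>

lemma nn_integral_eq_mass_imp_AE_eq_1:
  fixes f :: "'a \<Rightarrow> ennreal"
  assumes "finite_measure M" "f \<in> borel_measurable M" "AE x in M. f x \<le> 1"
    "(\<integral>\<^sup>+x. f x \<partial>M) = emeasure M (space M)"
  shows "AE x in M. f x = 1"
proof -
  interpret finite_measure M by fact
  have "(\<integral>\<^sup>+x. 1 - f x \<partial>M) = (\<integral>\<^sup>+x. 1 \<partial>M) - (\<integral>\<^sup>+x. f x \<partial>M)"
    using assms by (intro nn_integral_diff) (auto simp: emeasure_finite)
  also have "\<dots> = 0" using assms by (simp add: emeasure_finite)
  finally have "AE x in M. 1 - f x = 0"
    using assms by (subst (asm) nn_integral_0_iff_AE) auto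
  with assms(3) show ?thesis
    by eventually_elim (metis diff_eq_0_iff_ennreal ennreal_one_less_top leD order_le_less order_le_imp_less_or_eq)
qed

section \<open>Weak duality\<close>

locale hk_barycenter =
  fixes \<Omega> :: "'a::euclidean_space set" and \<rho> :: "'a measure" and \<kappa> :: real
  assumes compact: "compact \<Omega>" and \<rho>: "\<rho> \<in> radon_measures \<Omega>"
    and prob: "prob_space \<rho>" and \<kappa>: "0 < \<kappa>"
begin

sublocale prob_space \<rho> by (rule prob)

abbreviation "K \<equiv> kernel_transform \<kappa>"

text \<open>The closed form of \<open>HK2\<close> integrated over \<rho>, kept as a real number so
  that limits and differences avoid \<open>ennreal\<close> arithmetic.\<close>

definition primal_value :: "'a measure \<Rightarrow> real" where
  "primal_value \<nu> = 1 + measure \<nu> \<Omega> - 2 * (LINT x|\<rho>. sqrt (K \<nu> x))"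

lemma space_\<rho> [simp]: "space \<rho> = \<Omega>"
  using \<rho> by (rule radon_measuresD)

lemma prob_\<Omega> [simp]: "prob \<Omega> = 1"
  using prob_space by simp

lemma integrable_continuous:
  fixes f :: "'a \<Rightarrow> real"
  assumes "continuous_on \<Omega> f"
  shows "integrable \<rho> f"
proof -
  obtain B where "\<forall>x\<in>\<Omega>. norm (f x) \<le> B"
    using compact_imp_bounded[OF compact_continuous_image[OF assms compact]]
    unfolding bounded_iff by blast
  then show ?thesis
    using borel_measurable_radon_continuous[OF \<rho> assms] by (intro integrable_const_bound[of _ B]) auto
qed

lemma continuous_K: "\<nu> \<in> radon_measures \<Omega> \<Longrightarrow> continuous_on \<Omega> (K \<nu>)"
  by (rule continuous_on_kernel_transform[OF compact \<kappa>])

lemma integrable_sqrt_K: "\<nu> \<in> radon_measures \<Omega> \<Longrightarrow> integrable \<rho> (\<lambda>x. sqrt (K \<nu> x))"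
  by (intro integrable_continuous continuous_on_real_sqrt continuous_K)

text \<open>From \<open>K \<nu> x \<le> measure \<nu> \<Omega>\<close> and a completed square. It
  guarantees that \<open>ennreal\<close> truncates nothing in the closed form of
  \<open>HK2\<close>.\<close>

lemma HK2_value_nonneg:
  assumes "\<nu> \<in> radon_measures \<Omega>"
  shows "0 \<le> 1 + measure \<nu> \<Omega> - 2 * sqrt (K \<nu> x)"
proof -
  have "sqrt (K \<nu> x) \<le> sqrt (measure \<nu> \<Omega>)"
    using kernel_transform_le_mass[OF assms] by simp
  moreover have "0 \<le> (1 - sqrt (measure \<nu> \<Omega>))\<^sup>2" by simp
  then have "2 * sqrt (measure \<nu> \<Omega>) \<le> 1 + measure \<nu> \<Omega>" by (simp add: power2_diff)
  ultimately show ?thesis by linarith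
qed

text \<open>Coercivity: the transform is at most the mass, and replacing it by the mass completes
  the square. This bounds the masses of near-minimisers.\<close>

lemma primal_value_ge:
  assumes "\<nu> \<in> radon_measures \<Omega>"
  shows "(1 - sqrt (measure \<nu> \<Omega>))\<^sup>2 \<le> primal_value \<nu>"
proof -
  have "(LINT x|\<rho>. sqrt (K \<nu> x)) \<le> (LINT x|\<rho>. sqrt (measure \<nu> \<Omega>))"
    using kernel_transform_le_mass[OF assms] integrable_sqrt_K[OF assms] by (intro integral_mono) auto
  then show ?thesis by (simp add: primal_value_def power2_diff)
qed

lemma primal_value_nonneg: "\<nu> \<in> radon_measures \<Omega> \<Longrightarrow> 0 \<le> primal_value \<nu>"
  using primal_value_ge[of \<nu>] zero_le_power2[of "1 - sqrt (measure \<nu> \<Omega>)"] by linarith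

lemma primal_objective_eq:
  assumes "\<nu> \<in> radon_measures \<Omega>"
  shows "primal_objective \<Omega> \<rho> \<kappa> \<nu> = ennreal (primal_value \<nu>)"
proof -
  have "primal_objective \<Omega> \<rho> \<kappa> \<nu> = (\<integral>\<^sup>+x. ennreal (1 + measure \<nu> \<Omega> - 2 * sqrt (K \<nu> x)) \<partial>\<rho>)"
    unfolding primal_objective_def by (intro nn_integral_cong) (simp add: HK2_return_eq[OF \<kappa> assms])
  also have "\<dots> = ennreal (LINT x|\<rho>. 1 + measure \<nu> \<Omega> - 2 * sqrt (K \<nu> x))"
    using integrable_sqrt_K[OF assms] HK2_value_nonneg[OF assms] by (intro nn_integral_eq_integral) auto
  also have "(LINT x|\<rho>. 1 + measure \<nu> \<Omega> - 2 * sqrt (K \<nu> x)) = primal_value \<nu>"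
    using integrable_sqrt_K[OF assms] by (simp add: primal_value_def)
  finally show ?thesis .
qed

lemma dual_potentialsD:
  assumes "\<psi> \<in> dual_potentials \<Omega> \<rho>"
  shows "continuous_on \<Omega> \<psi>" "x \<in> \<Omega> \<Longrightarrow> \<psi> x \<le> 1" "AE x in \<rho>. \<psi> x < 1"
    "\<psi> \<in> borel_measurable \<rho>" "integrable \<rho> \<psi>"
  using assms borel_measurable_radon_continuous[OF \<rho>] integrable_continuous
  by (auto simp: dual_potentials_def)

lemma dual_potential_eq:
  "dual_potential \<rho> \<kappa> \<psi> y = (\<integral>\<^sup>+x. ennreal (cos_kernel \<kappa> x y / (1 - \<psi> x)) \<partial>\<rho>)"
  by (simp add: dual_potential_def cos_kernel_def)

text \<open>Both measures carry the restricted Borel algebra, so joint measurability is pulled back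
  from the full Borel product along the inclusion.\<close>

lemma cos_kernel_pair_measurable:
  assumes "\<nu> \<in> radon_measures \<Omega>" "\<psi> \<in> borel_measurable \<rho>"
  shows "(\<lambda>(y, x). ennreal (cos_kernel \<kappa> x y / (1 - \<psi> x))) \<in> borel_measurable (\<nu> \<Otimes>\<^sub>M \<rho>)"
proof -
  have 1: "(\<lambda>y. y) \<in> \<nu> \<rightarrow>\<^sub>M borel" "(\<lambda>y. y) \<in> \<rho> \<rightarrow>\<^sub>M borel"
    using assms(1) \<rho> by (auto intro: borel_measurable_radon)
  have "(\<lambda>z. (snd z, fst z)) \<in> \<nu> \<Otimes>\<^sub>M \<rho> \<rightarrow>\<^sub>M borel \<Otimes>\<^sub>M borel"
    by (intro measurable_Pair measurable_compose[OF measurable_snd 1(2)] measurable_compose[OF measurable_fst 1(1)])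
  from measurable_compose[OF this borel_measurable_cos_kernel[of \<kappa>]]
  have "(\<lambda>z. cos_kernel \<kappa> (snd z) (fst z)) \<in> borel_measurable (\<nu> \<Otimes>\<^sub>M \<rho>)" by simp
  moreover have "(\<lambda>z. \<psi> (snd z)) \<in> borel_measurable (\<nu> \<Otimes>\<^sub>M \<rho>)"
    using assms(2) by measurable
  ultimately show ?thesis unfolding case_prod_beta by measurable
qed

lemma dual_potential_measurable:
  assumes "\<nu> \<in> radon_measures \<Omega>" "\<psi> \<in> dual_potentials \<Omega> \<rho>"
  shows "dual_potential \<rho> \<kappa> \<psi> \<in> borel_measurable \<nu>"
  unfolding dual_potential_eq[abs_def]
  by (rule borel_measurable_nn_integral) (rule cos_kernel_pair_measurable[OF assms(1) dual_potentialsD(4)[OF assms(2)]])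

text \<open>Tonelli's theorem moves the constraint term of the Lagrangian to an integral against
  \<rho>. The bound \<open>\<psi> x \<le> 1\<close> at every point keeps the factor
  \<open>inverse (1 - \<psi> x)\<close> non-negative; where it is \<open>inverse 0 = 0\<close>, both
  sides vanish.\<close>

lemma nn_integral_dual_potential:
  assumes \<nu>: "\<nu> \<in> radon_measures \<Omega>" and \<psi>: "\<psi> \<in> dual_potentials \<Omega> \<rho>"
  shows "(\<integral>\<^sup>+y. dual_potential \<rho> \<kappa> \<psi> y \<partial>\<nu>) = (\<integral>\<^sup>+x. ennreal (K \<nu> x / (1 - \<psi> x)) \<partial>\<rho>)"
proof -
  interpret nu: finite_measure \<nu> using \<nu> by (rule radon_measuresD)
  interpret pair_sigma_finite \<nu> \<rho> ..
  have "(\<integral>\<^sup>+y. dual_potential \<rho> \<kappa> \<psi> y \<partial>\<nu>) = (\<integral>\<^sup>+x. \<integral>\<^sup>+y. ennreal (cos_kernel \<kappa> x y / (1 - \<psi> x)) \<partial>\<nu> \<partial>\<rho>)"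
    unfolding dual_potential_eq
    using Fubini'[OF cos_kernel_pair_measurable[OF \<nu> dual_potentialsD(4)[OF \<psi>]]] by simp
  also have "\<dots> = (\<integral>\<^sup>+x. ennreal (K \<nu> x / (1 - \<psi> x)) \<partial>\<rho>)"
  proof (rule nn_integral_cong)
    fix x assume "x \<in> space \<rho>"
    then have x: "0 \<le> inverse (1 - \<psi> x)" using dual_potentialsD(2)[OF \<psi>] by simp
    have "(\<integral>\<^sup>+y. ennreal (cos_kernel \<kappa> x y / (1 - \<psi> x)) \<partial>\<nu>) =
        (\<integral>\<^sup>+y. ennreal (cos_kernel \<kappa> x y) * ennreal (inverse (1 - \<psi> x)) \<partial>\<nu>)"
      using x by (simp add: divide_inverse ennreal_mult)
    also have "\<dots> = ennreal (K \<nu> x) * ennreal (inverse (1 - \<psi> x))"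
      by (subst nn_integral_multc) (auto intro: borel_measurable_radon[OF \<nu>] simp: nn_integral_cos_kernel[OF \<nu>])
    finally show "(\<integral>\<^sup>+y. ennreal (cos_kernel \<kappa> x y / (1 - \<psi> x)) \<partial>\<nu>) = ennreal (K \<nu> x / (1 - \<psi> x))"
      using x by (simp add: divide_inverse ennreal_mult)
  qed
  finally show ?thesis .
qed

text \<open>The integrand \<open>?f\<close> is a square over \<open>1 - \<psi> x\<close> almost
  everywhere, so its integral is non-negative and vanishes only if the square does. The function
  \<open>g\<close> is left general because the result is applied both to transforms and to the limit
  of a minimising sequence, which is not shown to be a transform.\<close>

lemma young_gap:
  assumes g: "continuous_on \<Omega> g" "\<And>x. x \<in> \<Omega> \<Longrightarrow> 0 \<le> g x" and \<psi>: "\<psi> \<in> dual_potentials \<Omega> \<rho>"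
    and int: "integrable \<rho> (\<lambda>x. g x / (1 - \<psi> x))"
  shows "dual_objective \<rho> \<psi> + 2 * (LINT x|\<rho>. sqrt (g x)) \<le> 1 + (LINT x|\<rho>. g x / (1 - \<psi> x))"
    and "dual_objective \<rho> \<psi> + 2 * (LINT x|\<rho>. sqrt (g x)) = 1 + (LINT x|\<rho>. g x / (1 - \<psi> x)) \<Longrightarrow>
      AE x in \<rho>. \<psi> x = 1 - sqrt (g x)"
proof -
  let ?f = "\<lambda>x. 1 + g x / (1 - \<psi> x) - (\<psi> x + 2 * sqrt (g x))"
  have sq: "integrable \<rho> (\<lambda>x. sqrt (g x))"
    using g by (intro integrable_continuous continuous_on_real_sqrt)
  have f_int: "integrable \<rho> ?f"
    using int sq dual_potentialsD(5)[OF \<psi>] by auto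
  have val: "(LINT x|\<rho>. ?f x) = 1 + (LINT x|\<rho>. g x / (1 - \<psi> x)) - (dual_objective \<rho> \<psi> + 2 * (LINT x|\<rho>. sqrt (g x)))"
    using int sq dual_potentialsD(5)[OF \<psi>] by (simp add: dual_objective_def)
  have id: "AE x in \<rho>. \<psi> x < 1 \<and> ?f x = (sqrt (g x) - (1 - \<psi> x))\<^sup>2 / (1 - \<psi> x)"
    using dual_potentialsD(3)[OF \<psi>] AE_space
  proof eventually_elim
    case (elim x)
    then show ?case using g(2)[of x]
      by (simp add: divide_simps power2_diff) (simp add: algebra_simps power2_eq_square)
  qed
  then have nn: "AE x in \<rho>. 0 \<le> ?f x" by eventually_elim simp
  then show "dual_objective \<rho> \<psi> + 2 * (LINT x|\<rho>. sqrt (g x)) \<le> 1 + (LINT x|\<rho>. g x / (1 - \<psi> x))"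
    using integral_nonneg_AE[OF nn] val by linarith
  assume "dual_objective \<rho> \<psi> + 2 * (LINT x|\<rho>. sqrt (g x)) = 1 + (LINT x|\<rho>. g x / (1 - \<psi> x))"
  then have "(LINT x|\<rho>. ?f x) = 0" using val by linarith
  then have "AE x in \<rho>. ?f x = 0"
    using integral_nonneg_eq_0_iff_AE[OF f_int nn] by blast
  with id show "AE x in \<rho>. \<psi> x = 1 - sqrt (g x)"
    by eventually_elim auto
qed

lemma integrable_quotient:
  assumes g: "continuous_on \<Omega> g" "\<And>x. x \<in> \<Omega> \<Longrightarrow> 0 \<le> g x" and \<psi>: "\<psi> \<in> dual_potentials \<Omega> \<rho>"
    and le: "(\<integral>\<^sup>+x. ennreal (g x / (1 - \<psi> x)) \<partial>\<rho>) < \<infinity>"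
  shows "integrable \<rho> (\<lambda>x. g x / (1 - \<psi> x))"
    and "(\<integral>\<^sup>+x. ennreal (g x / (1 - \<psi> x)) \<partial>\<rho>) = ennreal (LINT x|\<rho>. g x / (1 - \<psi> x))"
    and "0 \<le> (LINT x|\<rho>. g x / (1 - \<psi> x))"
proof -
  have nn: "AE x in \<rho>. 0 \<le> g x / (1 - \<psi> x)"
    using g(2) dual_potentialsD(2)[OF \<psi>] by (intro AE_I2) auto
  have "(\<lambda>x. g x / (1 - \<psi> x)) \<in> borel_measurable \<rho>"
    using borel_measurable_radon_continuous[OF \<rho> g(1)] dual_potentialsD(4)[OF \<psi>] by measurable
  then show int: "integrable \<rho> (\<lambda>x. g x / (1 - \<psi> x))"
  proof (rule integrableI_bounded)
    have "(\<integral>\<^sup>+x. ennreal (norm (g x / (1 - \<psi> x))) \<partial>\<rho>) = (\<integral>\<^sup>+x. ennreal (g x / (1 - \<psi> x)) \<partial>\<rho>)"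
      using nn by (intro nn_integral_cong_AE) (auto simp del: abs_divide)
    then show "(\<integral>\<^sup>+x. ennreal (norm (g x / (1 - \<psi> x))) \<partial>\<rho>) < \<infinity>" using le by simp
  qed
  show "(\<integral>\<^sup>+x. ennreal (g x / (1 - \<psi> x)) \<partial>\<rho>) = ennreal (LINT x|\<rho>. g x / (1 - \<psi> x))"
    by (rule nn_integral_eq_integral[OF int nn])
  show "0 \<le> (LINT x|\<rho>. g x / (1 - \<psi> x))"
    by (rule integral_nonneg_AE[OF nn])
qed

lemma dual_feasibleD:
  assumes "\<psi> \<in> dual_feasible \<Omega> \<rho> \<kappa>"
  shows "\<psi> \<in> dual_potentials \<Omega> \<rho>" "y \<in> \<Omega> \<Longrightarrow> dual_potential \<rho> \<kappa> \<psi> y \<le> 1"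
  using assms by (auto simp: dual_feasible_def)

lemma nn_integral_dual_potential_le:
  assumes \<nu>: "\<nu> \<in> radon_measures \<Omega>" and \<psi>: "\<psi> \<in> dual_feasible \<Omega> \<rho> \<kappa>"
  shows "(\<integral>\<^sup>+x. ennreal (K \<nu> x / (1 - \<psi> x)) \<partial>\<rho>) \<le> ennreal (measure \<nu> \<Omega>)"
proof -
  interpret nu: finite_measure \<nu> using \<nu> by (rule radon_measuresD)
  have sp: "space \<nu> = \<Omega>" using \<nu> by (rule radon_measuresD)
  have "(\<integral>\<^sup>+y. dual_potential \<rho> \<kappa> \<psi> y \<partial>\<nu>) \<le> (\<integral>\<^sup>+y. 1 \<partial>\<nu>)"
    using dual_feasibleD(2)[OF \<psi>] by (intro nn_integral_mono) (simp add: sp)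
  then show ?thesis
    by (simp add: nn_integral_dual_potential[OF \<nu> dual_feasibleD(1)[OF \<psi>]] sp nu.emeasure_eq_measure)
qed

lemma feasible_quotient:
  assumes \<nu>: "\<nu> \<in> radon_measures \<Omega>" and \<psi>: "\<psi> \<in> dual_feasible \<Omega> \<rho> \<kappa>"
  shows "integrable \<rho> (\<lambda>x. K \<nu> x / (1 - \<psi> x))"
    and "(\<integral>\<^sup>+y. dual_potential \<rho> \<kappa> \<psi> y \<partial>\<nu>) = ennreal (LINT x|\<rho>. K \<nu> x / (1 - \<psi> x))"
    and "0 \<le> (LINT x|\<rho>. K \<nu> x / (1 - \<psi> x))"
    and "(LINT x|\<rho>. K \<nu> x / (1 - \<psi> x)) \<le> measure \<nu> \<Omega>"
proof -
  have fin: "(\<integral>\<^sup>+x. ennreal (K \<nu> x / (1 - \<psi> x)) \<partial>\<rho>) < \<infinity>"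
    using nn_integral_dual_potential_le[OF assms] by (rule le_less_trans) simp
  note q = integrable_quotient[OF continuous_K[OF \<nu>] kernel_transform_nonneg dual_feasibleD(1)[OF \<psi>] fin]
  show "integrable \<rho> (\<lambda>x. K \<nu> x / (1 - \<psi> x))"
    "(\<integral>\<^sup>+y. dual_potential \<rho> \<kappa> \<psi> y \<partial>\<nu>) = ennreal (LINT x|\<rho>. K \<nu> x / (1 - \<psi> x))"
    "0 \<le> (LINT x|\<rho>. K \<nu> x / (1 - \<psi> x))"
    using q nn_integral_dual_potential[OF \<nu> dual_feasibleD(1)[OF \<psi>]] by auto
  show "(LINT x|\<rho>. K \<nu> x / (1 - \<psi> x)) \<le> measure \<nu> \<Omega>"
    using nn_integral_dual_potential_le[OF assms] q by simp
qed

text \<open>One part of the gap is the mass of \<nu> minus the integral of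
  \<open>K \<nu> x / (1 - \<psi> x)\<close>, non-negative by feasibility; the other is the gap in
  \<open>young_gap\<close>. The first vanishes when the constraint is tight for \<nu>, the second
  when \<psi> is one minus the root of the transform.\<close>

lemma weak_duality:
  assumes \<nu>: "\<nu> \<in> radon_measures \<Omega>" and \<psi>: "\<psi> \<in> dual_feasible \<Omega> \<rho> \<kappa>"
  shows "dual_objective \<rho> \<psi> \<le> primal_value \<nu>"
    and "dual_objective \<rho> \<psi> = primal_value \<nu> \<longleftrightarrow> optimality_conditions \<rho> \<kappa> \<nu> \<psi>"
proof -
  interpret nu: finite_measure \<nu> using \<nu> by (rule radon_measuresD)
  have sp: "space \<nu> = \<Omega>" using \<nu> by (rule radon_measuresD)
  note pot = dual_feasibleD(1)[OF \<psi>]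
  note q = feasible_quotient[OF assms]
  note y = young_gap[OF continuous_K[OF \<nu>] kernel_transform_nonneg pot q(1)]
  show "dual_objective \<rho> \<psi> \<le> primal_value \<nu>"
    using y(1) q(4) by (simp add: primal_value_def)
  have opt: "optimality_conditions \<rho> \<kappa> \<nu> \<psi> \<longleftrightarrow>
      (AE x in \<rho>. \<psi> x = 1 - sqrt (K \<nu> x)) \<and> (AE y in \<nu>. dual_potential \<rho> \<kappa> \<psi> y = 1)"
    by (simp add: optimality_conditions_def kernel_transform_def cos_kernel_def)
  show "dual_objective \<rho> \<psi> = primal_value \<nu> \<longleftrightarrow> optimality_conditions \<rho> \<kappa> \<nu> \<psi>"
  proof
    assume eq: "dual_objective \<rho> \<psi> = primal_value \<nu>"
    then have *: "(LINT x|\<rho>. K \<nu> x / (1 - \<psi> x)) = measure \<nu> \<Omega>"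
      "dual_objective \<rho> \<psi> + 2 * (LINT x|\<rho>. sqrt (K \<nu> x)) = 1 + (LINT x|\<rho>. K \<nu> x / (1 - \<psi> x))"
      using y(1) q(4) by (auto simp: primal_value_def)
    have "AE y in \<nu>. dual_potential \<rho> \<kappa> \<psi> y = 1"
    proof (rule nn_integral_eq_mass_imp_AE_eq_1)
      show "AE y in \<nu>. dual_potential \<rho> \<kappa> \<psi> y \<le> 1"
        using dual_feasibleD(2)[OF \<psi>] by (intro AE_I2) (simp add: sp)
      show "(\<integral>\<^sup>+y. dual_potential \<rho> \<kappa> \<psi> y \<partial>\<nu>) = emeasure \<nu> (space \<nu>)"
        by (simp add: q(2) * sp nu.emeasure_eq_measure)
    qed (use dual_potential_measurable[OF \<nu> pot] nu.finite_measure_axioms in auto)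
    with y(2)[OF *(2)] show "optimality_conditions \<rho> \<kappa> \<nu> \<psi>" by (simp add: opt)
  next
    assume "optimality_conditions \<rho> \<kappa> \<nu> \<psi>"
    then have AE: "AE x in \<rho>. \<psi> x = 1 - sqrt (K \<nu> x)" "AE y in \<nu>. dual_potential \<rho> \<kappa> \<psi> y = 1"
      by (auto simp: opt)
    have "(\<integral>\<^sup>+y. dual_potential \<rho> \<kappa> \<psi> y \<partial>\<nu>) = (\<integral>\<^sup>+y. 1 \<partial>\<nu>)"
      using AE(2) by (intro nn_integral_cong_AE) auto
    then have M: "(LINT x|\<rho>. K \<nu> x / (1 - \<psi> x)) = measure \<nu> \<Omega>"
      using q(2,3) by (simp add: sp nu.emeasure_eq_measure)
    \<comment> \<open>Inserting the formula for \<psi> turns the quotient into the root (zeros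
      included, as \<open>0 / 0 = 0\<close>). Hence the mass of \<nu> is the integral of the root,
      and both objectives equal one minus that mass.\<close>
    have "AE x in \<rho>. K \<nu> x / (1 - \<psi> x) = sqrt (K \<nu> x)"
      using AE(1) by eventually_elim (simp add: real_div_sqrt)
    then have "(LINT x|\<rho>. K \<nu> x / (1 - \<psi> x)) = (LINT x|\<rho>. sqrt (K \<nu> x))"
      using q(1) integrable_sqrt_K[OF \<nu>] by (intro integral_cong_AE) auto
    moreover have "dual_objective \<rho> \<psi> = (LINT x|\<rho>. 1 - sqrt (K \<nu> x))"
      unfolding dual_objective_def
      using AE(1) dual_potentialsD(4)[OF pot] integrable_sqrt_K[OF \<nu>] by (intro integral_cong_AE) auto
    then have "dual_objective \<rho> \<psi> = 1 - (LINT x|\<rho>. sqrt (K \<nu> x))"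
      using integrable_sqrt_K[OF \<nu>] by simp
    ultimately show "dual_objective \<rho> \<psi> = primal_value \<nu>"
      using M by (simp add: primal_value_def)
  qed
qed

end

section \<open>Perturbation of measures\<close>

definition plus_measure :: "'a measure \<Rightarrow> 'a measure \<Rightarrow> 'a measure" where
  "plus_measure M N = measure_of (space M) (sets M) (\<lambda>A. emeasure M A + emeasure N A)"

lemma space_plus_measure [simp]: "space (plus_measure M N) = space M"
  and sets_plus_measure [simp]: "sets (plus_measure M N) = sets M"
  by (auto simp: plus_measure_def)

lemma emeasure_plus_measure:
  assumes "sets N = sets M" "A \<in> sets M"
  shows "emeasure (plus_measure M N) A = emeasure M A + emeasure N A"
  unfolding plus_measure_def
proof (rule emeasure_measure_of_sigma)
  show "countably_additive (sets M) (\<lambda>A. emeasure M A + emeasure N A)"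
  proof (rule countably_additiveI)
    fix F :: "nat \<Rightarrow> 'a set"
    assume F: "range F \<subseteq> sets M" "disjoint_family F" "\<Union> (range F) \<in> sets M"
    show "(\<Sum>i. emeasure M (F i) + emeasure N (F i)) = emeasure M (\<Union> (range F)) + emeasure N (\<Union> (range F))"
      using F assms by (simp add: suminf_add[symmetric] suminf_emeasure)
  qed
qed (use assms in \<open>auto simp: positive_def intro: sets.sigma_algebra_axioms\<close>)

lemma nn_integral_plus_measure:
  assumes N: "sets N = sets M" and f: "f \<in> borel_measurable M"
  shows "(\<integral>\<^sup>+x. f x \<partial>plus_measure M N) = (\<integral>\<^sup>+x. f x \<partial>M) + (\<integral>\<^sup>+x. f x \<partial>N)"
  using f
proof (induction rule: borel_measurable_induct)
  case (cong f g)
  then show ?case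
    using nn_integral_cong[of M f g] nn_integral_cong[of N f g] nn_integral_cong[of "plus_measure M N" f g]
      sets_eq_imp_space_eq[OF N] by auto
next
  case (set A)
  then show ?case using N by (simp add: emeasure_plus_measure)
next
  case (mult u c)
  then have "u \<in> borel_measurable N" "u \<in> borel_measurable (plus_measure M N)"
    using N by (auto cong: measurable_cong_sets)
  then show ?case using mult by (simp add: nn_integral_cmult distrib_left)
next
  case (add u v)
  then have "u \<in> borel_measurable N" "u \<in> borel_measurable (plus_measure M N)"
    "v \<in> borel_measurable N" "v \<in> borel_measurable (plus_measure M N)"
    using N by (auto cong: measurable_cong_sets)
  then show ?case using add by (simp add: nn_integral_add ac_simps)
next
  case (seq U)
  have U: "U i \<in> borel_measurable N" "U i \<in> borel_measurable (plus_measure M N)" for i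
    using seq N by (auto cong: measurable_cong_sets)
  have inc: "incseq (\<lambda>i. integral\<^sup>N M (U i))" for M :: "'a measure"
    by (intro incseq_SucI nn_integral_mono le_funD[OF incseq_SucD[OF seq(3)]])
  have "(\<integral>\<^sup>+x. (SUP i. U i) x \<partial>L) = (SUP i. integral\<^sup>N L (U i))"
    if "\<And>i. U i \<in> borel_measurable L" for L
    using nn_integral_monotone_convergence_SUP[OF seq(3) that] by (simp add: image_comp)
  then show ?case
    using seq U ennreal_SUP_add[OF inc inc] by simp
qed

text \<open>A variation by a Dirac mass changes mass and transform affinely; the direction
  \<open>y\<close> produces the dual constraint at the point \<open>y\<close>.\<close>

lemma plus_scaled_return:
  fixes S :: "'a::euclidean_space set"
  assumes \<nu>: "\<nu> \<in> radon_measures S" and y: "y \<in> S" and t: "0 \<le> t"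
  defines "\<nu>' \<equiv> plus_measure \<nu> (scale_measure (ennreal t) (return (restrict_space borel S) y))"
  shows "\<nu>' \<in> radon_measures S" and "measure \<nu>' S = measure \<nu> S + t"
    and "kernel_transform \<kappa> \<nu>' x = kernel_transform \<kappa> \<nu> x + t * cos_kernel \<kappa> x y"
proof -
  interpret nu: finite_measure \<nu> using \<nu> by (rule radon_measuresD)
  have sets: "sets \<nu> = sets (restrict_space borel S)" and sp: "space \<nu> = S"
    using \<nu> by (auto dest: radon_measuresD)
  let ?N = "scale_measure (ennreal t) (return (restrict_space borel S) y)"
  have S: "S \<in> sets \<nu>" using sets.top[of \<nu>] by (simp add: sp)
  have mass: "emeasure \<nu>' S = ennreal (measure \<nu> S + t)"
    using S y t sets unfolding \<nu>'_def
    by (subst emeasure_plus_measure) (auto simp: nu.emeasure_eq_measure ennreal_plus)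
  interpret nu': finite_measure \<nu>'
    by standard (simp add: \<nu>'_def sp mass[unfolded \<nu>'_def])
  show rad: "\<nu>' \<in> radon_measures S"
    using sets nu'.finite_measure_axioms by (simp add: radon_measures_def \<nu>'_def)
  show "measure \<nu>' S = measure \<nu> S + t"
    using t by (intro measure_eq_emeasure_eq_ennreal mass) auto
  have k: "cos_kernel \<kappa> x \<in> borel_measurable (restrict_space borel S)"
    by (intro measurable_restrict_space1) measurable
  have "ennreal (kernel_transform \<kappa> \<nu>' x) = (\<integral>\<^sup>+z. ennreal (cos_kernel \<kappa> x z) \<partial>\<nu>')"
    by (rule nn_integral_cos_kernel[OF rad, symmetric])
  also have "\<dots> = ennreal (kernel_transform \<kappa> \<nu> x) + (\<integral>\<^sup>+z. ennreal (cos_kernel \<kappa> x z) \<partial>?N)"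
    unfolding \<nu>'_def nn_integral_cos_kernel[OF \<nu>, symmetric]
    using borel_measurable_radon[OF \<nu> cos_kernel_measurable[of \<kappa> x]] sets
    by (intro nn_integral_plus_measure) auto
  also have "(\<integral>\<^sup>+z. ennreal (cos_kernel \<kappa> x z) \<partial>?N) = ennreal (t * cos_kernel \<kappa> x y)"
    using k y t by (simp add: nn_integral_scale_measure nn_integral_return space_restrict_space ennreal_mult)
  finally show "kernel_transform \<kappa> \<nu>' x = kernel_transform \<kappa> \<nu> x + t * cos_kernel \<kappa> x y"
    using t by (simp flip: ennreal_plus)
qed

text \<open>Scaling is the variation that identifies the limiting mass of a minimising sequence; it
  also supplies heavy point masses against infeasible potentials.\<close>

lemma scale_radon_measure:
  fixes S :: "'a::euclidean_space set"
  assumes \<nu>: "\<nu> \<in> radon_measures S" and r: "0 \<le> r"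
  defines "\<nu>' \<equiv> scale_measure (ennreal r) \<nu>"
  shows "\<nu>' \<in> radon_measures S" and "measure \<nu>' S = r * measure \<nu> S"
    and "kernel_transform \<kappa> \<nu>' x = r * kernel_transform \<kappa> \<nu> x"
proof -
  interpret nu: finite_measure \<nu> using \<nu> by (rule radon_measuresD)
  have sets: "sets \<nu> = sets (restrict_space borel S)" and sp: "space \<nu> = S"
    using \<nu> by (auto dest: radon_measuresD)
  interpret nu': finite_measure \<nu>'
    by standard (simp add: \<nu>'_def ennreal_mult_eq_top_iff nu.emeasure_finite)
  show rad: "\<nu>' \<in> radon_measures S"
    using sets nu'.finite_measure_axioms by (simp add: radon_measures_def \<nu>'_def)
  show "measure \<nu>' S = r * measure \<nu> S"
    using r by (simp add: \<nu>'_def measure_scale_measure)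
  have "ennreal (kernel_transform \<kappa> \<nu>' x) = (\<integral>\<^sup>+y. ennreal (cos_kernel \<kappa> x y) \<partial>\<nu>')"
    by (rule nn_integral_cos_kernel[OF rad, symmetric])
  also have "\<dots> = ennreal r * ennreal (kernel_transform \<kappa> \<nu> x)"
    unfolding nn_integral_cos_kernel[OF \<nu>, symmetric] \<nu>'_def
    using borel_measurable_radon[OF \<nu> cos_kernel_measurable[of \<kappa> x]]
    by (intro nn_integral_scale_measure) auto
  finally show "kernel_transform \<kappa> \<nu>' x = r * kernel_transform \<kappa> \<nu> x"
    using r by (simp flip: ennreal_mult)
qed

text \<open>The zero measure shows that competitors exist, bounds the primal infimum by 1, and
  reduces the Lagrangian to the dual objective.\<close>

lemma null_measure_radon:
  fixes S :: "'a::euclidean_space set"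
  defines "\<nu> \<equiv> null_measure (restrict_space borel S) :: 'a measure"
  shows "\<nu> \<in> radon_measures S" "measure \<nu> A = 0" "kernel_transform \<kappa> \<nu> x = 0"
proof -
  show "\<nu> \<in> radon_measures S"
    by (auto simp: radon_measures_def \<nu>_def intro: finite_measureI)
  show "measure \<nu> A = 0" by (simp add: \<nu>_def measure_def)
  have "AE y in \<nu>. cos_kernel \<kappa> x y = 0"
    by (rule AE_I[of _ _ "space \<nu>"]) (auto simp: \<nu>_def)
  then show "kernel_transform \<kappa> \<nu> x = 0"
    unfolding kernel_transform_def by (rule integral_eq_zero_AE)
qed

section \<open>The limit of a minimising sequence\<close>

context hk_barycenter begin

definition primal_inf :: real where
  "primal_inf = Inf (primal_value ` radon_measures \<Omega>)"

lemma primal_value_bdd_below: "bdd_below (primal_value ` radon_measures \<Omega>)"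
  using primal_value_nonneg by (auto intro!: bdd_belowI[of _ 0])

lemma primal_inf_le: "\<nu> \<in> radon_measures \<Omega> \<Longrightarrow> primal_inf \<le> primal_value \<nu>"
  unfolding primal_inf_def by (intro cInf_lower primal_value_bdd_below) auto

lemma primal_inf_le_1: "primal_inf \<le> 1"
  using primal_inf_le[OF null_measure_radon(1)] null_measure_radon(2,3)[where S = \<Omega>]
  by (simp add: primal_value_def)

text \<open>Coercivity with a convenient threshold: 4 lies above \<open>primal_inf \<le> 1\<close>,
  and its root 2 gives \<open>sqrt (measure \<nu> \<Omega>) \<le> 3\<close>.\<close>

lemma mass_le_of_primal_value_le:
  assumes "\<nu> \<in> radon_measures \<Omega>" "primal_value \<nu> \<le> 4"
  shows "measure \<nu> \<Omega> \<le> 9"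
proof -
  have "(sqrt (measure \<nu> \<Omega>) - 1)\<^sup>2 \<le> 2\<^sup>2"
    using primal_value_ge[OF assms(1)] assms(2) by (simp add: power2_commute)
  then have "sqrt (measure \<nu> \<Omega>) - 1 \<le> 2" by (rule power2_le_imp_le) simp
  then have "sqrt (measure \<nu> \<Omega>) \<le> 3" by simp
  then show ?thesis using sqrt_le_D[of "measure \<nu> \<Omega>" 3] by simp
qed

lemma minimizing_sequence:
  obtains \<nu> where "\<And>n::nat. \<nu> n \<in> radon_measures \<Omega>" "\<And>n. measure (\<nu> n) \<Omega> \<le> 9"
    "(\<lambda>n. primal_value (\<nu> n)) \<longlonglongrightarrow> primal_inf"
proof -
  have ne: "primal_value ` radon_measures \<Omega> \<noteq> {}" using null_measure_radon(1) by blast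
  have "\<exists>\<nu>\<in>radon_measures \<Omega>. primal_value \<nu> < primal_inf + 1 / real (Suc n)" for n
    using cInf_lessD[OF ne, of "primal_inf + 1 / real (Suc n)"] unfolding primal_inf_def by auto
  then obtain \<nu> where \<nu>: "\<And>n. \<nu> n \<in> radon_measures \<Omega>"
    "\<And>n. primal_value (\<nu> n) < primal_inf + 1 / real (Suc n)" by metis
  have "1 / real (Suc n) \<le> 1" for n by simp
  then have "primal_value (\<nu> n) \<le> 4" for n
    using \<nu>(2)[of n] primal_inf_le_1 by (smt (verit))
  moreover have "(\<lambda>n. primal_value (\<nu> n)) \<longlonglongrightarrow> primal_inf"
  proof (rule tendsto_sandwich[where f = "\<lambda>_. primal_inf" and h = "\<lambda>n. primal_inf + 1 / real (Suc n)"])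
    show "(\<lambda>n. primal_inf + 1 / real (Suc n)) \<longlonglongrightarrow> primal_inf"
      using tendsto_add[OF tendsto_const LIMSEQ_inverse_real_of_nat, of primal_inf]
      by (simp add: divide_inverse)
    show "\<forall>\<^sub>F n in sequentially. primal_value (\<nu> n) \<le> primal_inf + 1 / real (Suc n)"
      using less_imp_le[OF \<nu>(2)] by (rule always_eventually[OF allI])
  qed (use \<nu> primal_inf_le in \<open>auto intro!: always_eventually less_imp_le\<close>)
  ultimately show ?thesis using that \<nu>(1) mass_le_of_primal_value_le by blast
qed

lemma limit_transform:
  obtains \<nu> g where "\<And>n::nat. \<nu> n \<in> radon_measures \<Omega>" "\<And>n. measure (\<nu> n) \<Omega> \<le> 9"
    "(\<lambda>n. primal_value (\<nu> n)) \<longlonglongrightarrow> primal_inf" "continuous_on \<Omega> g"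
    "\<And>x. x \<in> \<Omega> \<Longrightarrow> (\<lambda>n. K (\<nu> n) x) \<longlonglongrightarrow> g x"
proof -
  obtain \<nu> where \<nu>: "\<And>n::nat. \<nu> n \<in> radon_measures \<Omega>" "\<And>n. measure (\<nu> n) \<Omega> \<le> 9"
    "(\<lambda>n. primal_value (\<nu> n)) \<longlonglongrightarrow> primal_inf"
    using minimizing_sequence by blast
  have bound: "norm (K (\<nu> n) x) \<le> 9" for n x
    using kernel_transform_le_mass[OF \<nu>(1)[of n], of \<kappa> x] \<nu>(2)[of n] by simp
  have equi: "\<exists>d>0. \<forall>n y. y \<in> \<Omega> \<and> norm (x - y) < d \<longrightarrow> norm (K (\<nu> n) x - K (\<nu> n) y) < e"
    if "x \<in> \<Omega>" "0 < e" for x e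
  proof -
    \<comment> \<open>The masses are at most 9, so tolerance \<open>e / 10\<close> per unit of mass
      leaves a strict inequality.\<close>
    obtain d where d: "0 < d"
      "\<And>\<nu> x x'. \<lbrakk>\<nu> \<in> radon_measures \<Omega>; x \<in> \<Omega>; x' \<in> \<Omega>; dist x x' < d\<rbrakk> \<Longrightarrow>
        \<bar>K \<nu> x - K \<nu> x'\<bar> \<le> (e / 10) * measure \<nu> \<Omega>"
      using kernel_transform_equicontinuous[OF compact \<kappa>, of "e / 10"] \<open>0 < e\<close> by auto
    have "norm (K (\<nu> n) x - K (\<nu> n) y) < e" if "y \<in> \<Omega>" "norm (x - y) < d" for n y
    proof -
      have "\<bar>K (\<nu> n) x - K (\<nu> n) y\<bar> \<le> (e / 10) * measure (\<nu> n) \<Omega>"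
        using d(2)[OF \<nu>(1)] \<open>x \<in> \<Omega>\<close> that by (simp add: dist_norm)
      also have "\<dots> \<le> (e / 10) * 9" using \<nu>(2)[of n] \<open>0 < e\<close> by (intro mult_left_mono) auto
      also have "\<dots> < e" using \<open>0 < e\<close> by simp
      finally show ?thesis by simp
    qed
    then show ?thesis using d(1) by blast
  qed
  obtain g r where g: "continuous_on \<Omega> g" "strict_mono (r :: nat \<Rightarrow> nat)"
    "\<And>e. 0 < e \<Longrightarrow> \<exists>N. \<forall>n x. n \<ge> N \<and> x \<in> \<Omega> \<longrightarrow> norm (K (\<nu> (r n)) x - g x) < e"
    using Arzela_Ascoli[OF compact, of "\<lambda>n. K (\<nu> n)" 9] bound equi by metis
  show ?thesis
  proof
    show "(\<lambda>n. primal_value (\<nu> (r n))) \<longlonglongrightarrow> primal_inf"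
      using LIMSEQ_subseq_LIMSEQ[OF \<nu>(3) g(2)] by (simp add: comp_def)
    show "(\<lambda>n. K (\<nu> (r n)) x) \<longlonglongrightarrow> g x" if "x \<in> \<Omega>" for x
      using g(3) that by (intro LIMSEQ_I) blast
  qed (use \<nu> g in auto)
qed

end

text \<open>If the values differed at \<open>x\<close>, disjoint neighbourhoods of them would pull
  back to a relatively open neighbourhood of \<open>x\<close> on which the functions differ
  everywhere. It has positive measure because \<open>x\<close> lies in the support.\<close>

lemma continuous_AE_eq_on_support:
  fixes f g :: "'a::euclidean_space \<Rightarrow> 'b::t2_space"
  assumes \<mu>: "\<mu> \<in> radon_measures S" and f: "continuous_on S f" and g: "continuous_on S g"
    and AE: "AE x in \<mu>. f x = g x" and x: "x \<in> measure_support S \<mu>"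
  shows "f x = g x"
proof (rule ccontr)
  assume "f x \<noteq> g x"
  then obtain V W where VW: "open V" "open W" "f x \<in> V" "g x \<in> W" "V \<inter> W = {}"
    using hausdorff[OF \<open>f x \<noteq> g x\<close>] by blast
  obtain A where A: "open A" "A \<inter> S = f -` V \<inter> S"
    using f VW(1) by (auto simp: continuous_on_open_invariant)
  obtain B where B: "open B" "B \<inter> S = g -` W \<inter> S"
    using g VW(2) by (auto simp: continuous_on_open_invariant)
  have xS: "x \<in> S" using x by (simp add: measure_support_def)
  have "x \<in> A \<inter> S" "x \<in> B \<inter> S" unfolding A(2) B(2) using VW xS by auto
  then have "open (A \<inter> B)" "x \<in> A \<inter> B" using A(1) B(1) by auto
  then have pos: "0 < emeasure \<mu> (A \<inter> B \<inter> S)" using x by (auto simp: measure_support_def)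
  have sp: "space \<mu> = S" and sets: "sets \<mu> = sets (restrict_space borel S)"
    using \<mu> by (auto dest: radon_measuresD)
  have "A \<inter> B \<inter> S \<in> sets \<mu>"
    unfolding sets sets_restrict_space using A(1) B(1) by (intro image_eqI[of _ _ "A \<inter> B"]) auto
  moreover have "AE z in \<mu>. z \<notin> A \<inter> B \<inter> S"
    using AE
  proof eventually_elim
    case (elim z)
    show ?case
    proof
      assume "z \<in> A \<inter> B \<inter> S"
      then have "z \<in> A \<inter> S" "z \<in> B \<inter> S" by auto
      then have "f z \<in> V" "g z \<in> W" unfolding A(2) B(2) by auto
      then show False using elim VW(5) by auto
    qed
  qed
  ultimately have "emeasure \<mu> (A \<inter> B \<inter> S) = 0"
    using AE_iff_measurable[of "A \<inter> B \<inter> S" \<mu> "\<lambda>z. z \<notin> A \<inter> B \<inter> S"] by (auto simp: sp)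
  with pos show False by simp
qed

section \<open>First-order conditions on the limit and dual attainment\<close>

context hk_barycenter begin

text \<open>Collects what is used of the limit \<open>g\<close>: the value it attains, the
  first-order inequality in Dirac directions, and a Fatou bound. The last one stands in for testing
  feasibility against a primal minimiser.\<close>

lemma optimal_transform:
  obtains g where "continuous_on \<Omega> g" "\<And>x. x \<in> \<Omega> \<Longrightarrow> 0 \<le> g x"
    "primal_inf = 1 - (LINT x|\<rho>. sqrt (g x))"
    "\<And>y t. \<lbrakk>y \<in> \<Omega>; 0 < t\<rbrakk> \<Longrightarrow>
      2 * (LINT x|\<rho>. sqrt (g x + t * cos_kernel \<kappa> x y)) - 2 * (LINT x|\<rho>. sqrt (g x)) \<le> t"
    "\<And>\<psi>. \<psi> \<in> dual_feasible \<Omega> \<rho> \<kappa> \<Longrightarrow>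
      (\<integral>\<^sup>+x. ennreal (g x / (1 - \<psi> x)) \<partial>\<rho>) \<le> ennreal (LINT x|\<rho>. sqrt (g x))"
proof -
  obtain \<nu> g where \<nu>: "\<And>n::nat. \<nu> n \<in> radon_measures \<Omega>" "\<And>n. measure (\<nu> n) \<Omega> \<le> 9"
    "(\<lambda>n. primal_value (\<nu> n)) \<longlonglongrightarrow> primal_inf" and g: "continuous_on \<Omega> g"
    and lim: "\<And>x. x \<in> \<Omega> \<Longrightarrow> (\<lambda>n. K (\<nu> n) x) \<longlonglongrightarrow> g x"
    using limit_transform by blast
  have g0: "0 \<le> g x" if "x \<in> \<Omega>" for x
    using lim[OF that] by (rule LIMSEQ_le_const) auto
  define G where "G = (LINT x|\<rho>. sqrt (g x))"
  \<comment> \<open>The value forced on the limit of the masses once the primal values and the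
    integrals of the roots converge.\<close>
  define m where "m = primal_inf - 1 + 2 * G"
  have G0: "0 \<le> G" unfolding G_def using g0 by (intro integral_nonneg_AE AE_I2) auto
  \<comment> \<open>With masses at most 9 the constant \<open>sqrt (9 + t)\<close> dominates;
    \<open>t = 0\<close> gives the unperturbed integrals.\<close>
  have conv: "(\<lambda>n. LINT x|\<rho>. sqrt (K (\<nu> n) x + t * cos_kernel \<kappa> x y)) \<longlonglongrightarrow>
      (LINT x|\<rho>. sqrt (g x + t * cos_kernel \<kappa> x y))" if "0 \<le> t" for t y
  proof (rule integral_dominated_convergence[where w = "\<lambda>_. sqrt (9 + t)"])
    have k: "continuous_on \<Omega> (\<lambda>x. t * cos_kernel \<kappa> x y)"
      by (intro continuous_on_mult_left continuous_on_cos_kernel_left \<kappa>)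
    show "(\<lambda>x. sqrt (g x + t * cos_kernel \<kappa> x y)) \<in> borel_measurable \<rho>"
      by (intro borel_measurable_radon_continuous[OF \<rho>] continuous_on_real_sqrt continuous_on_add g k)
    show "(\<lambda>x. sqrt (K (\<nu> n) x + t * cos_kernel \<kappa> x y)) \<in> borel_measurable \<rho>" for n
      by (intro borel_measurable_radon_continuous[OF \<rho>] continuous_on_real_sqrt continuous_on_add continuous_K \<nu> k)
    show "AE x in \<rho>. (\<lambda>n. sqrt (K (\<nu> n) x + t * cos_kernel \<kappa> x y)) \<longlonglongrightarrow> sqrt (g x + t * cos_kernel \<kappa> x y)"
      using lim by (intro AE_I2 tendsto_real_sqrt tendsto_add tendsto_const) auto
    have "K (\<nu> n) x + t * cos_kernel \<kappa> x y \<le> 9 + t" for n x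
      using kernel_transform_le_mass[OF \<nu>(1)[of n], of \<kappa> x] \<nu>(2)[of n] that
        mult_left_mono[OF cos_kernel_le_1 that, of \<kappa> x y] by simp
    then show "AE x in \<rho>. norm (sqrt (K (\<nu> n) x + t * cos_kernel \<kappa> x y)) \<le> sqrt (9 + t)" for n
      using that by (intro AE_I2) simp
  qed simp
  have convG: "(\<lambda>n. LINT x|\<rho>. sqrt (K (\<nu> n) x)) \<longlonglongrightarrow> G"
    using conv[of 0] by (simp add: G_def)
  have convm: "(\<lambda>n. measure (\<nu> n) \<Omega>) \<longlonglongrightarrow> m"
  proof -
    have "(\<lambda>n. primal_value (\<nu> n) - 1 + 2 * (LINT x|\<rho>. sqrt (K (\<nu> n) x))) \<longlonglongrightarrow> m"
      unfolding m_def by (intro tendsto_intros \<nu>(3) convG)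
    then show ?thesis by (simp add: primal_value_def)
  qed
  have m0: "0 \<le> m" using convm by (rule LIMSEQ_le_const) auto
  have perturb: "2 * (LINT x|\<rho>. sqrt (g x + t * cos_kernel \<kappa> x y)) - 2 * G \<le> t" if "y \<in> \<Omega>" "0 < t" for y t
  proof -
    note p = plus_scaled_return[OF \<nu>(1) \<open>y \<in> \<Omega>\<close> less_imp_le[OF \<open>0 < t\<close>]]
    have "(\<lambda>n. 1 + (measure (\<nu> n) \<Omega> + t) - 2 * (LINT x|\<rho>. sqrt (K (\<nu> n) x + t * cos_kernel \<kappa> x y)))
        \<longlonglongrightarrow> 1 + (m + t) - 2 * (LINT x|\<rho>. sqrt (g x + t * cos_kernel \<kappa> x y))"
      using that by (intro tendsto_intros convm conv) simp
    moreover have "primal_inf \<le> 1 + (measure (\<nu> n) \<Omega> + t) - 2 * (LINT x|\<rho>. sqrt (K (\<nu> n) x + t * cos_kernel \<kappa> x y))" for n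
      using primal_inf_le[OF p(1)[of n]] by (simp only: primal_value_def p(2,3))
    ultimately have "primal_inf \<le> 1 + (m + t) - 2 * (LINT x|\<rho>. sqrt (g x + t * cos_kernel \<kappa> x y))"
      by (intro LIMSEQ_le_const) auto
    then show ?thesis by (simp add: m_def)
  qed
  \<comment> \<open>Scaling by a square makes the root integral scale linearly in \<open>u\<close>,
    so the inequality is quadratic in \<open>u\<close>.\<close>
  have scale: "0 \<le> u\<^sup>2 * m - 2 * (u * G) - m + 2 * G" if "0 \<le> u" for u
  proof -
    note s = scale_radon_measure[OF \<nu>(1) zero_le_power2[of u]]
    have "(\<lambda>n. 1 + u\<^sup>2 * measure (\<nu> n) \<Omega> - 2 * (u * (LINT x|\<rho>. sqrt (K (\<nu> n) x)))) \<longlonglongrightarrow> 1 + u\<^sup>2 * m - 2 * (u * G)"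
      by (intro tendsto_intros convm convG)
    moreover have "primal_inf \<le> 1 + u\<^sup>2 * measure (\<nu> n) \<Omega> - 2 * (u * (LINT x|\<rho>. sqrt (K (\<nu> n) x)))" for n
      using primal_inf_le[OF s(1)[of n]] that by (simp add: primal_value_def s(2,3) real_sqrt_mult)
    ultimately have "primal_inf \<le> 1 + u\<^sup>2 * m - 2 * (u * G)"
      by (intro LIMSEQ_le_const) auto
    then show ?thesis by (simp add: m_def)
  qed
  \<comment> \<open>The vertex \<open>u = G / m\<close> of the quadratic gives
    \<open>0 \<le> - (G - m)\<^sup>2\<close>. For \<open>m = 0\<close> the expression is linear and
    \<open>u = 2\<close> forces \<open>G = 0\<close>.\<close>
  have mG: "m = G"
  proof (cases "m = 0")
    case True
    then show ?thesis using scale[of 2] G0 by simp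
  next
    case False
    then have "0 < m" using m0 by simp
    have "0 \<le> ((G / m)\<^sup>2 * m - 2 * (G / m * G) - m + 2 * G) * m"
      using scale[of "G / m"] G0 m0 by (intro mult_nonneg_nonneg) auto
    also have "\<dots> = - (G - m)\<^sup>2"
      using \<open>0 < m\<close> by (simp add: power2_eq_square field_simps)
    finally show ?thesis by simp
  qed
  \<comment> \<open>The factor \<open>1 / (1 - \<psi> x)\<close> may be unbounded, which rules out
    dominated convergence by a constant; the one-sided bound from Fatou's lemma is enough.\<close>
  have fatou: "(\<integral>\<^sup>+x. ennreal (g x / (1 - \<psi> x)) \<partial>\<rho>) \<le> ennreal G" if \<psi>: "\<psi> \<in> dual_feasible \<Omega> \<rho> \<kappa>" for \<psi>
  proof -
    note pot = dual_feasibleD(1)[OF \<psi>]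
    have "(\<integral>\<^sup>+x. ennreal (g x / (1 - \<psi> x)) \<partial>\<rho>) = (\<integral>\<^sup>+x. liminf (\<lambda>n. ennreal (K (\<nu> n) x / (1 - \<psi> x))) \<partial>\<rho>)"
    proof (rule nn_integral_cong)
      fix x assume "x \<in> space \<rho>"
      then have "(\<lambda>n. ennreal (K (\<nu> n) x * inverse (1 - \<psi> x))) \<longlonglongrightarrow> ennreal (g x * inverse (1 - \<psi> x))"
        using lim by (intro tendsto_ennrealI tendsto_mult tendsto_const) auto
      then show "ennreal (g x / (1 - \<psi> x)) = liminf (\<lambda>n. ennreal (K (\<nu> n) x / (1 - \<psi> x)))"
        by (simp add: divide_inverse lim_imp_Liminf)
    qed
    also have "\<dots> \<le> liminf (\<lambda>n. \<integral>\<^sup>+x. ennreal (K (\<nu> n) x / (1 - \<psi> x)) \<partial>\<rho>)"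
      using borel_measurable_radon_continuous[OF \<rho> continuous_K[OF \<nu>(1)]] dual_potentialsD(4)[OF pot]
      by (intro nn_integral_liminf) auto
    also have "\<dots> \<le> liminf (\<lambda>n. ennreal (measure (\<nu> n) \<Omega>))"
      by (intro Liminf_mono always_eventually allI nn_integral_dual_potential_le \<nu> \<psi>)
    also have "\<dots> = ennreal G"
      using convm by (intro lim_imp_Liminf tendsto_ennrealI) (auto simp: mG)
    finally show ?thesis .
  qed
  show ?thesis
    using that[OF g g0] perturb fatou m_def mG unfolding G_def by simp
qed

text \<open>Where \<open>g\<close> vanishes and the kernel does not, adding mass \<open>t\<close> at
  \<open>y\<close> raises the root by order \<open>sqrt t\<close>, while the inequality permits only
  order \<open>t\<close>. So such points form a null set for each \<open>y\<close>.\<close>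

lemma positive_of_perturbation:
  assumes g: "continuous_on \<Omega> g" "\<And>x. x \<in> \<Omega> \<Longrightarrow> 0 \<le> g x"
    and perturb: "\<And>y t. \<lbrakk>y \<in> \<Omega>; 0 < t\<rbrakk> \<Longrightarrow>
      2 * (LINT x|\<rho>. sqrt (g x + t * cos_kernel \<kappa> x y)) - 2 * (LINT x|\<rho>. sqrt (g x)) \<le> t"
  shows "AE x in \<rho>. 0 < g x"
proof -
  have zero: "AE x in \<rho>. g x = 0 \<longrightarrow> cos_kernel \<kappa> x y = 0" if y: "y \<in> \<Omega>" for y
  proof -
    define h where "h = (\<lambda>x. if g x = 0 then sqrt (cos_kernel \<kappa> x y) else 0)"
    have [measurable]: "g \<in> borel_measurable \<rho>" "(\<lambda>x. cos_kernel \<kappa> x y) \<in> borel_measurable \<rho>"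
      by (auto intro!: borel_measurable_radon_continuous[OF \<rho>] g continuous_on_cos_kernel_left \<kappa>)
    have h: "integrable \<rho> h"
      by (rule integrable_const_bound[of _ 1]) (auto simp: h_def)
    have sq: "integrable \<rho> (\<lambda>x. sqrt (g x))"
      by (intro integrable_continuous continuous_on_real_sqrt g)
    have sqt: "integrable \<rho> (\<lambda>x. sqrt (g x + t * cos_kernel \<kappa> x y))" for t
      by (intro integrable_continuous continuous_on_real_sqrt continuous_on_add continuous_on_mult_left
          continuous_on_cos_kernel_left \<kappa> g)
    have small: "(LINT x|\<rho>. h x) \<le> e" if "0 < e" for e
    proof -
      \<comment> \<open>Take \<open>t = e\<^sup>2\<close>: on the zero set of \<open>g\<close> the
        root grows by exactly \<open>e * h x\<close>, and elsewhere it does not decrease.\<close>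
      have "(LINT x|\<rho>. e * h x) \<le> (LINT x|\<rho>. sqrt (g x + e\<^sup>2 * cos_kernel \<kappa> x y) - sqrt (g x))"
        using g(2) h sq sqt \<open>0 < e\<close> by (intro integral_mono) (auto simp: h_def real_sqrt_mult)
      also have "\<dots> \<le> e\<^sup>2 / 2" using perturb[OF y, of "e\<^sup>2"] \<open>0 < e\<close> sq sqt by simp
      finally have "e * (LINT x|\<rho>. h x) \<le> e * (e / 2)" by (simp add: power2_eq_square)
      then have "(LINT x|\<rho>. h x) \<le> e / 2" using \<open>0 < e\<close> by simp
      then show ?thesis using \<open>0 < e\<close> by simp
    qed
    have nn: "AE x in \<rho>. 0 \<le> h x" by (simp add: h_def)
    have "(LINT x|\<rho>. h x) = 0"
      using field_le_epsilon[of "LINT x|\<rho>. h x" 0] small integral_nonneg_AE[OF nn] by (intro antisym) auto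
    then have "AE x in \<rho>. h x = 0" using integral_nonneg_eq_0_iff_AE[OF h nn] by blast
    then show ?thesis by eventually_elim (simp add: h_def split: if_splits)
  qed
  \<comment> \<open>The kernel is positive within distance \<open>\<kappa> * pi / 2\<close>, so
    finitely many \<open>y\<close> reach every point of \<Omega> and only finitely many null sets
    are joined.\<close>
  obtain Y where Y: "finite Y" "Y \<subseteq> \<Omega>" "\<Omega> \<subseteq> (\<Union>y\<in>Y. ball y (\<kappa> * pi / 2))"
  proof (rule compactE_image[OF compact, of \<Omega> "\<lambda>y. ball y (\<kappa> * pi / 2)"])
    show "\<Omega> \<subseteq> (\<Union>y\<in>\<Omega>. ball y (\<kappa> * pi / 2))" using \<kappa> by force
  qed auto
  have "AE x in \<rho>. \<forall>y\<in>Y. g x = 0 \<longrightarrow> cos_kernel \<kappa> x y = 0"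
    using Y zero by (intro AE_finite_allI) auto
  then show ?thesis using AE_space
  proof eventually_elim
    case (elim x)
    then obtain y where "y \<in> Y" "dist x y < \<kappa> * pi / 2" using Y(3) by (auto simp: dist_commute)
    then have "0 < cos_kernel \<kappa> x y" by (simp add: cos_kernel_pos_iff[OF \<kappa>])
    then show ?case using elim \<open>y \<in> Y\<close> g(2)[of x] by force
  qed
qed

text \<open>The difference quotients of twice the root have integral at most 1. Where
  \<open>g\<close> is positive, hence almost everywhere, they converge to the kernel over
  \<open>sqrt (g x)\<close>, the integrand of the dual potential, and Fatou's lemma preserves the
  bound.\<close>

lemma feasible_of_perturbation:
  assumes g: "continuous_on \<Omega> g" "\<And>x. x \<in> \<Omega> \<Longrightarrow> 0 \<le> g x"
    and perturb: "\<And>y t. \<lbrakk>y \<in> \<Omega>; 0 < t\<rbrakk> \<Longrightarrow>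
      2 * (LINT x|\<rho>. sqrt (g x + t * cos_kernel \<kappa> x y)) - 2 * (LINT x|\<rho>. sqrt (g x)) \<le> t"
  shows "(\<lambda>x. 1 - sqrt (g x)) \<in> dual_feasible \<Omega> \<rho> \<kappa>"
proof -
  have pos: "AE x in \<rho>. 0 < g x" by (rule positive_of_perturbation) (fact assms)+
  have "dual_potential \<rho> \<kappa> (\<lambda>x. 1 - sqrt (g x)) y \<le> 1" if y: "y \<in> \<Omega>" for y
  proof -
    define t where "t = (\<lambda>n. inverse (real (Suc n)))"
    have t: "0 < t n" for n by (simp add: t_def)
    define f where "f = (\<lambda>n x. 2 * (sqrt (g x + t n * cos_kernel \<kappa> x y) - sqrt (g x)) / t n)"
    have cont: "continuous_on \<Omega> (f n)" for n
      unfolding f_def using t[of n]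
      by (intro continuous_on_divide continuous_on_mult_left continuous_on_diff continuous_on_real_sqrt
          continuous_on_add continuous_on_cos_kernel_left \<kappa> g continuous_on_const) auto
    have f0: "0 \<le> f n x" for n x using t[of n] by (simp add: f_def)
    have le1: "(\<integral>\<^sup>+x. ennreal (f n x) \<partial>\<rho>) \<le> 1" for n
    proof -
      have i: "integrable \<rho> (\<lambda>x. sqrt (g x + t n * cos_kernel \<kappa> x y))" "integrable \<rho> (\<lambda>x. sqrt (g x))"
        by (intro integrable_continuous continuous_on_real_sqrt continuous_on_add continuous_on_mult_left
            continuous_on_cos_kernel_left \<kappa> g)+
      have "(LINT x|\<rho>. f n x) =
          (2 * (LINT x|\<rho>. sqrt (g x + t n * cos_kernel \<kappa> x y)) - 2 * (LINT x|\<rho>. sqrt (g x))) / t n"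
        unfolding f_def using i by (simp add: right_diff_distrib)
      also have "\<dots> \<le> 1" using perturb[OF y t[of n]] t[of n] by simp
      finally show ?thesis
        using nn_integral_eq_integral[OF integrable_continuous[OF cont[of n]]] f0 by simp
    qed
    have "dual_potential \<rho> \<kappa> (\<lambda>x. 1 - sqrt (g x)) y = (\<integral>\<^sup>+x. liminf (\<lambda>n. ennreal (f n x)) \<partial>\<rho>)"
      unfolding dual_potential_eq
    proof (rule nn_integral_cong_AE)
      show "AE x in \<rho>. ennreal (cos_kernel \<kappa> x y / (1 - (1 - sqrt (g x)))) = liminf (\<lambda>n. ennreal (f n x))"
        using pos
      proof eventually_elim
        case (elim x)
        let ?k = "cos_kernel \<kappa> x y"
        \<comment> \<open>Rationalising the numerator removes the division by \<open>t n\<close>, so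
          that the limit can be read off by continuity.\<close>
        have "f n x = 2 * ?k / (sqrt (g x + t n * ?k) + sqrt (g x))" for n
        proof -
          have "0 \<le> t n * ?k" using t[of n] by simp
          then have p: "0 < sqrt (g x + t n * ?k) + sqrt (g x)" using elim by (intro add_nonneg_pos) auto
          have "(sqrt (g x + t n * ?k) - sqrt (g x)) * (sqrt (g x + t n * ?k) + sqrt (g x)) = t n * ?k"
            using elim \<open>0 \<le> t n * ?k\<close> by (simp add: algebra_simps)
          then have "2 * (sqrt (g x + t n * ?k) - sqrt (g x)) * (sqrt (g x + t n * ?k) + sqrt (g x)) = 2 * ?k * t n"
            by algebra
          then show ?thesis using p t[of n] unfolding f_def by (subst frac_eq_eq) auto
        qed
        moreover have "(\<lambda>n. 2 * ?k / (sqrt (g x + t n * ?k) + sqrt (g x))) \<longlonglongrightarrow>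
            2 * ?k / (sqrt (g x + 0 * ?k) + sqrt (g x))"
          using elim unfolding t_def by (intro tendsto_intros LIMSEQ_inverse_real_of_nat) auto
        ultimately have "(\<lambda>n. f n x) \<longlonglongrightarrow> ?k / sqrt (g x)" by simp
        then have "(\<lambda>n. ennreal (f n x)) \<longlonglongrightarrow> ennreal (?k / sqrt (g x))" by (rule tendsto_ennrealI)
        then show ?case by (simp add: lim_imp_Liminf)
      qed
    qed
    also have "\<dots> \<le> liminf (\<lambda>n. \<integral>\<^sup>+x. ennreal (f n x) \<partial>\<rho>)"
      using borel_measurable_radon_continuous[OF \<rho> cont] by (intro nn_integral_liminf) auto
    also have "\<dots> \<le> liminf (\<lambda>n::nat. 1::ennreal)"
      using le1 by (intro Liminf_mono always_eventually) auto
    finally show ?thesis by (simp add: Liminf_const)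
  qed
  moreover have "(\<lambda>x. 1 - sqrt (g x)) \<in> dual_potentials \<Omega> \<rho>"
    using g pos by (auto simp: dual_potentials_def intro!: continuous_on_diff continuous_on_real_sqrt continuous_on_const)
  ultimately show ?thesis by (simp add: dual_feasible_def)
qed

text \<open>The maximiser is one minus the root of the limit transform. Comparing any other
  maximiser with this same \<open>g\<close> settles uniqueness almost everywhere.\<close>

lemma dual_optimum:
  obtains \<psi>\<^sub>0 where "\<psi>\<^sub>0 \<in> dual_feasible \<Omega> \<rho> \<kappa>" "dual_objective \<rho> \<psi>\<^sub>0 = primal_inf"
    "\<And>\<psi>. \<lbrakk>\<psi> \<in> dual_feasible \<Omega> \<rho> \<kappa>; dual_objective \<rho> \<psi> = primal_inf\<rbrakk> \<Longrightarrow> AE x in \<rho>. \<psi> x = \<psi>\<^sub>0 x"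
proof -
  obtain g where g: "continuous_on \<Omega> g" "\<And>x. x \<in> \<Omega> \<Longrightarrow> 0 \<le> g x"
    and inf: "primal_inf = 1 - (LINT x|\<rho>. sqrt (g x))"
    and perturb: "\<And>y t. \<lbrakk>y \<in> \<Omega>; 0 < t\<rbrakk> \<Longrightarrow>
      2 * (LINT x|\<rho>. sqrt (g x + t * cos_kernel \<kappa> x y)) - 2 * (LINT x|\<rho>. sqrt (g x)) \<le> t"
    and le: "\<And>\<psi>. \<psi> \<in> dual_feasible \<Omega> \<rho> \<kappa> \<Longrightarrow>
      (\<integral>\<^sup>+x. ennreal (g x / (1 - \<psi> x)) \<partial>\<rho>) \<le> ennreal (LINT x|\<rho>. sqrt (g x))"
    using optimal_transform by blast
  have sq: "integrable \<rho> (\<lambda>x. sqrt (g x))"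
    by (intro integrable_continuous continuous_on_real_sqrt g)
  have G0: "0 \<le> (LINT x|\<rho>. sqrt (g x))" using g(2) by (intro integral_nonneg_AE AE_I2) auto
  show ?thesis
  proof
    show "(\<lambda>x. 1 - sqrt (g x)) \<in> dual_feasible \<Omega> \<rho> \<kappa>"
      by (rule feasible_of_perturbation[OF g perturb])
    show "dual_objective \<rho> (\<lambda>x. 1 - sqrt (g x)) = primal_inf"
      using sq by (simp add: dual_objective_def inf)
    show "AE x in \<rho>. \<psi> x = 1 - sqrt (g x)"
      if \<psi>: "\<psi> \<in> dual_feasible \<Omega> \<rho> \<kappa>" and eq: "dual_objective \<rho> \<psi> = primal_inf" for \<psi>
    proof -
      note pot = dual_feasibleD(1)[OF \<psi>]
      have "(\<integral>\<^sup>+x. ennreal (g x / (1 - \<psi> x)) \<partial>\<rho>) < \<infinity>"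
        using le[OF \<psi>] by (rule le_less_trans) simp
      note q = integrable_quotient[OF g pot this]
      \<comment> \<open>As the objective of \<psi> is one minus the integral of
        \<open>sqrt (g x)\<close>, this bound is the reverse of the inequality in
        \<open>young_gap\<close> and puts \<psi> in its equality case.\<close>
      have "(LINT x|\<rho>. g x / (1 - \<psi> x)) \<le> (LINT x|\<rho>. sqrt (g x))"
        using le[OF \<psi>] q(2,3) G0 by simp
      then show ?thesis
        using young_gap[OF g pot q(1)] eq inf by simp
    qed
  qed
qed

end

section \<open>Lagrangian duality and optimality\<close>

context hk_barycenter begin

section \<open>Optimal values and optimisers\<close>

lemma INF_primal_objective:
  "(INF \<nu> \<in> radon_measures \<Omega>. primal_objective \<Omega> \<rho> \<kappa> \<nu>) = ennreal primal_inf"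
proof (rule antisym)
  obtain \<nu> where \<nu>: "\<And>n::nat. \<nu> n \<in> radon_measures \<Omega>" "(\<lambda>n. primal_value (\<nu> n)) \<longlonglongrightarrow> primal_inf"
    by (rule minimizing_sequence) (rule that)
  have "(INF \<nu> \<in> radon_measures \<Omega>. primal_objective \<Omega> \<rho> \<kappa> \<nu>) \<le> ennreal (primal_value (\<nu> n))" for n
    using \<nu>(1) by (intro INF_lower2[of "\<nu> n"]) (auto simp: primal_objective_eq)
  then show "(INF \<nu> \<in> radon_measures \<Omega>. primal_objective \<Omega> \<rho> \<kappa> \<nu>) \<le> ennreal primal_inf"
    by (intro LIMSEQ_le_const[OF tendsto_ennrealI[OF \<nu>(2)]]) auto
  show "ennreal primal_inf \<le> (INF \<nu> \<in> radon_measures \<Omega>. primal_objective \<Omega> \<rho> \<kappa> \<nu>)"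
    by (intro INF_greatest) (simp add: primal_objective_eq ennreal_leI primal_inf_le)
qed

lemma primal_inf_nonneg: "0 \<le> primal_inf"
  unfolding primal_inf_def using null_measure_radon(1) primal_value_nonneg
  by (intro cInf_greatest) auto

lemma dual_objective_le_primal_inf:
  "\<psi> \<in> dual_feasible \<Omega> \<rho> \<kappa> \<Longrightarrow> dual_objective \<rho> \<psi> \<le> primal_inf"
  unfolding primal_inf_def using null_measure_radon(1) weak_duality(1)
  by (intro cInf_greatest) auto

lemma primal_optimal_iff:
  "primal_optimal \<Omega> \<rho> \<kappa> \<nu> \<longleftrightarrow> \<nu> \<in> radon_measures \<Omega> \<and> primal_value \<nu> = primal_inf"
proof -
  have *: "\<not> (\<exists>\<nu>'. \<nu>' \<in> radon_measures \<Omega> \<and> primal_objective \<Omega> \<rho> \<kappa> \<nu>' < primal_objective \<Omega> \<rho> \<kappa> \<nu>)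
      \<longleftrightarrow> primal_value \<nu> = primal_inf" (is "?L \<longleftrightarrow> _") if \<nu>: "\<nu> \<in> radon_measures \<Omega>"
  proof
    assume ?L
    then have "\<forall>\<nu>'\<in>radon_measures \<Omega>. primal_objective \<Omega> \<rho> \<kappa> \<nu> \<le> primal_objective \<Omega> \<rho> \<kappa> \<nu>'"
      by (meson not_le)
    then have "ennreal (primal_value \<nu>) \<le> ennreal primal_inf"
      unfolding INF_primal_objective[symmetric] primal_objective_eq[OF \<nu>, symmetric]
      by (intro INF_greatest) blast
    then show "primal_value \<nu> = primal_inf"
      using primal_inf_le[OF \<nu>] primal_inf_nonneg by simp
  next
    assume "primal_value \<nu> = primal_inf"
    then show ?L using primal_inf_le \<nu>
      by (auto simp: primal_objective_eq not_less ennreal_leI)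
  qed
  then show ?thesis by (auto simp: primal_optimal_def is_arg_min_def)
qed

text \<open>\<open>is_arg_max\<close> only excludes larger values; since some feasible potential
  attains the upper bound \<open>primal_inf\<close>, maximality becomes an equation.\<close>

lemma dual_optimal_iff:
  "dual_optimal \<Omega> \<rho> \<kappa> \<psi> \<longleftrightarrow> \<psi> \<in> dual_feasible \<Omega> \<rho> \<kappa> \<and> dual_objective \<rho> \<psi> = primal_inf"
proof -
  obtain \<psi>\<^sub>0 where "\<psi>\<^sub>0 \<in> dual_feasible \<Omega> \<rho> \<kappa>" "dual_objective \<rho> \<psi>\<^sub>0 = primal_inf"
    by (rule dual_optimum) (rule that)
  then show ?thesis
    using dual_objective_le_primal_inf unfolding dual_optimal_def is_arg_max_def by force
qed

lemma SUP_dual_objective: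
  "(SUP \<psi> \<in> dual_feasible \<Omega> \<rho> \<kappa>. ereal (dual_objective \<rho> \<psi>)) = ereal primal_inf"
proof -
  obtain \<psi>\<^sub>0 where \<psi>\<^sub>0: "\<psi>\<^sub>0 \<in> dual_feasible \<Omega> \<rho> \<kappa>" "dual_objective \<rho> \<psi>\<^sub>0 = primal_inf"
    by (rule dual_optimum) (rule that)
  show ?thesis
  proof (rule antisym)
    show "(SUP \<psi> \<in> dual_feasible \<Omega> \<rho> \<kappa>. ereal (dual_objective \<rho> \<psi>)) \<le> ereal primal_inf"
      by (intro SUP_least) (simp add: dual_objective_le_primal_inf)
    show "ereal primal_inf \<le> (SUP \<psi> \<in> dual_feasible \<Omega> \<rho> \<kappa>. ereal (dual_objective \<rho> \<psi>))"
      using \<psi>\<^sub>0 by (intro SUP_upper2[of \<psi>\<^sub>0]) auto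
  qed
qed

text \<open>Lowering \<psi> enlarges \<open>1 - \<psi> x\<close> and thus decreases the dual
  potential. The inequality becomes strict at every point, including those where \<psi> equals 1, at
  the price \<open>e\<close> in the objective.\<close>

lemma shift_feasible:
  assumes \<psi>: "\<psi> \<in> dual_feasible \<Omega> \<rho> \<kappa>" and e: "0 < e"
  shows "(\<lambda>x. \<psi> x - e) \<in> dual_feasible \<Omega> \<rho> \<kappa>" "dual_objective \<rho> (\<lambda>x. \<psi> x - e) = dual_objective \<rho> \<psi> - e"
    "x \<in> \<Omega> \<Longrightarrow> \<psi> x - e < 1"
proof -
  note pot = dual_feasibleD(1)[OF \<psi>]
  show lt: "\<psi> x - e < 1" if "x \<in> \<Omega>" for x using dual_potentialsD(2)[OF pot that] e by linarith
  have "dual_potential \<rho> \<kappa> (\<lambda>x. \<psi> x - e) y \<le> 1" if "y \<in> \<Omega>" for y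
  proof -
    have "dual_potential \<rho> \<kappa> (\<lambda>x. \<psi> x - e) y \<le> dual_potential \<rho> \<kappa> \<psi> y"
      unfolding dual_potential_eq
    proof (rule nn_integral_mono_AE)
      show "AE x in \<rho>. ennreal (cos_kernel \<kappa> x y / (1 - (\<psi> x - e))) \<le> ennreal (cos_kernel \<kappa> x y / (1 - \<psi> x))"
        using dual_potentialsD(3)[OF pot]
        by eventually_elim (use e in \<open>auto intro!: ennreal_leI divide_left_mono\<close>)
    qed
    then show ?thesis using dual_feasibleD(2)[OF \<psi> that] by simp
  qed
  moreover have "AE x in \<rho>. \<psi> x - e < 1" by (rule AE_I2) (simp add: lt)
  ultimately show "(\<lambda>x. \<psi> x - e) \<in> dual_feasible \<Omega> \<rho> \<kappa>"
    using less_imp_le[OF lt] dual_potentialsD(1)[OF pot]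
    by (auto simp: dual_feasible_def dual_potentials_def intro!: continuous_on_diff continuous_on_const)
  show "dual_objective \<rho> (\<lambda>x. \<psi> x - e) = dual_objective \<rho> \<psi> - e"
    using dual_potentialsD(5)[OF pot] by (simp add: dual_objective_def)
qed

text \<open>Covers the constraint \<open>\<psi> < 1\<close> read at every point: downward shifts of
  a maximiser satisfy it and lose arbitrarily little.\<close>

lemma SUP_dual_objective_strict:
  "(SUP \<psi> \<in> {\<psi> \<in> dual_feasible \<Omega> \<rho> \<kappa>. \<forall>x\<in>\<Omega>. \<psi> x < 1}. ereal (dual_objective \<rho> \<psi>)) = ereal primal_inf"
  (is "?S = _")
proof (rule antisym)
  show "?S \<le> ereal primal_inf"
    by (intro SUP_least) (simp add: dual_objective_le_primal_inf)
  obtain \<psi>\<^sub>0 where \<psi>\<^sub>0: "\<psi>\<^sub>0 \<in> dual_feasible \<Omega> \<rho> \<kappa>" "dual_objective \<rho> \<psi>\<^sub>0 = primal_inf"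
    by (rule dual_optimum) (rule that)
  have "ereal primal_inf \<le> ?S + ereal e" if "0 < e" for e
  proof -
    have "ereal (primal_inf - e) \<le> ?S"
    proof (rule SUP_upper2)
      show "(\<lambda>x. \<psi>\<^sub>0 x - e) \<in> {\<psi> \<in> dual_feasible \<Omega> \<rho> \<kappa>. \<forall>x\<in>\<Omega>. \<psi> x < 1}"
        using shift_feasible(1,3)[OF \<psi>\<^sub>0(1) that] by simp
      show "ereal (primal_inf - e) \<le> ereal (dual_objective \<rho> (\<lambda>x. \<psi>\<^sub>0 x - e))"
        by (simp only: shift_feasible(2)[OF \<psi>\<^sub>0(1) that] \<psi>\<^sub>0(2) order_refl)
    qed
    then have "ereal (primal_inf - e) + ereal e \<le> ?S + ereal e" by (rule add_right_mono)
    then show ?thesis by simp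
  qed
  then show "ereal primal_inf \<le> ?S" by (simp add: ereal_le_epsilon2)
qed

section \<open>Extremal values of the Lagrangian\<close>

lemma lagrangian_eq:
  assumes "\<nu> \<in> radon_measures \<Omega>" "\<psi> \<in> dual_potentials \<Omega> \<rho>"
  shows "lagrangian \<rho> \<kappa> \<psi> \<nu> = ereal (dual_objective \<rho> \<psi> + measure \<nu> \<Omega>)
    - enn2ereal (\<integral>\<^sup>+x. ennreal (K \<nu> x / (1 - \<psi> x)) \<partial>\<rho>)"
  using nn_integral_dual_potential[OF assms] radon_measuresD(2)[OF assms(1)] by (simp add: lagrangian_def)

text \<open>The upper bound is \<open>young_gap\<close>. The formal maximiser, one minus the root of
  the transform, may equal 1 on a set of positive measure, so it is approached by potentials
  regularised under the root.\<close>

lemma SUP_lagrangian: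
  assumes \<nu>: "\<nu> \<in> radon_measures \<Omega>"
  shows "(SUP \<psi> \<in> dual_potentials \<Omega> \<rho>. lagrangian \<rho> \<kappa> \<psi> \<nu>) = ereal (primal_value \<nu>)"
proof (rule antisym)
  show "(SUP \<psi> \<in> dual_potentials \<Omega> \<rho>. lagrangian \<rho> \<kappa> \<psi> \<nu>) \<le> ereal (primal_value \<nu>)"
  proof (rule SUP_least)
    fix \<psi> assume \<psi>: "\<psi> \<in> dual_potentials \<Omega> \<rho>"
    show "lagrangian \<rho> \<kappa> \<psi> \<nu> \<le> ereal (primal_value \<nu>)"
    proof (cases "(\<integral>\<^sup>+x. ennreal (K \<nu> x / (1 - \<psi> x)) \<partial>\<rho>) < \<infinity>")
      case True
      note q = integrable_quotient[OF continuous_K[OF \<nu>] kernel_transform_nonneg \<psi> True]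
      show ?thesis
        using young_gap(1)[OF continuous_K[OF \<nu>] kernel_transform_nonneg \<psi> q(1)] q(3)
        unfolding lagrangian_eq[OF \<nu> \<psi>] q(2) by (simp add: primal_value_def)
    next
      case False
      then have "(\<integral>\<^sup>+x. ennreal (K \<nu> x / (1 - \<psi> x)) \<partial>\<rho>) = \<infinity>" using less_top by fastforce
      then show ?thesis unfolding lagrangian_eq[OF \<nu> \<psi>] by simp
    qed
  qed
  have approx: "ereal (primal_value \<nu>) \<le> (SUP \<psi> \<in> dual_potentials \<Omega> \<rho>. lagrangian \<rho> \<kappa> \<psi> \<nu>) + ereal e"
    if "0 < e" for e
  proof -
    \<comment> \<open>The regularisation costs at most \<open>d\<close> in the dual objective and at
      most \<open>d\<close> in the constraint term.\<close>
    define d where "d = e / 2"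
    have d: "0 < d" using that by (simp add: d_def)
    define \<psi> where "\<psi> = (\<lambda>x. 1 - sqrt (K \<nu> x + d\<^sup>2))"
    have pos: "0 < K \<nu> x + d\<^sup>2" for x using d by (intro add_nonneg_pos) auto
    have le: "sqrt (K \<nu> x + d\<^sup>2) \<le> sqrt (K \<nu> x) + d" for x
      using sqrt_add_le_add_sqrt[of "K \<nu> x" "d\<^sup>2"] d by simp
    have \<psi>: "\<psi> \<in> dual_potentials \<Omega> \<rho>"
      using pos less_imp_le[OF pos] unfolding dual_potentials_def \<psi>_def
      by (auto intro!: continuous_on_diff continuous_on_real_sqrt continuous_on_add continuous_K \<nu> continuous_on_const)
    have "1 - (sqrt (K \<nu> x) + d) \<le> \<psi> x" for x using le[of x] by (simp add: \<psi>_def)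
    then have "(LINT x|\<rho>. 1 - (sqrt (K \<nu> x) + d)) \<le> dual_objective \<rho> \<psi>"
      unfolding dual_objective_def using integrable_sqrt_K[OF \<nu>] dual_potentialsD(5)[OF \<psi>]
      by (intro integral_mono) auto
    then have obj: "1 - (LINT x|\<rho>. sqrt (K \<nu> x)) - d \<le> dual_objective \<rho> \<psi>"
      using integrable_sqrt_K[OF \<nu>] by simp
    have "(\<integral>\<^sup>+x. ennreal (K \<nu> x / (1 - \<psi> x)) \<partial>\<rho>) \<le> (\<integral>\<^sup>+x. ennreal (sqrt (K \<nu> x) + d) \<partial>\<rho>)"
    proof (intro nn_integral_mono ennreal_leI)
      fix x
      have "K \<nu> x / (1 - \<psi> x) \<le> (K \<nu> x + d\<^sup>2) / sqrt (K \<nu> x + d\<^sup>2)"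
        using less_imp_le[OF pos[of x]] by (auto simp: \<psi>_def intro!: divide_right_mono)
      also have "\<dots> = sqrt (K \<nu> x + d\<^sup>2)" using less_imp_le[OF pos[of x]] by (rule real_div_sqrt)
      also have "\<dots> \<le> sqrt (K \<nu> x) + d" by (rule le)
      finally show "K \<nu> x / (1 - \<psi> x) \<le> sqrt (K \<nu> x) + d" .
    qed
    also have "\<dots> = ennreal ((LINT x|\<rho>. sqrt (K \<nu> x)) + d)"
      using integrable_sqrt_K[OF \<nu>] d by (subst nn_integral_eq_integral) auto
    finally have "enn2ereal (\<integral>\<^sup>+x. ennreal (K \<nu> x / (1 - \<psi> x)) \<partial>\<rho>) \<le>
        enn2ereal (ennreal ((LINT x|\<rho>. sqrt (K \<nu> x)) + d))"
      by (simp only: less_eq_ennreal.rep_eq)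
    also have "\<dots> = ereal ((LINT x|\<rho>. sqrt (K \<nu> x)) + d)"
      using d by (intro enn2ereal_ennreal add_nonneg_nonneg integral_nonneg_AE) auto
    finally have cost: "enn2ereal (\<integral>\<^sup>+x. ennreal (K \<nu> x / (1 - \<psi> x)) \<partial>\<rho>) \<le> \<dots>" .
    have "ereal (primal_value \<nu> - e) \<le> ereal (dual_objective \<rho> \<psi> + measure \<nu> \<Omega>) - ereal ((LINT x|\<rho>. sqrt (K \<nu> x)) + d)"
      using obj by (simp add: primal_value_def d_def)
    also have "\<dots> \<le> lagrangian \<rho> \<kappa> \<psi> \<nu>"
      unfolding lagrangian_eq[OF \<nu> \<psi>] by (intro ereal_minus_mono cost) simp
    also have "\<dots> \<le> (SUP \<psi> \<in> dual_potentials \<Omega> \<rho>. lagrangian \<rho> \<kappa> \<psi> \<nu>)"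
      by (rule SUP_upper[OF \<psi>])
    finally have "ereal (primal_value \<nu> - e) + ereal e \<le> (SUP \<psi> \<in> dual_potentials \<Omega> \<rho>. lagrangian \<rho> \<kappa> \<psi> \<nu>) + ereal e"
      by (rule add_right_mono)
    then show ?thesis by simp
  qed
  then show "ereal (primal_value \<nu>) \<le> (SUP \<psi> \<in> dual_potentials \<Omega> \<rho>. lagrangian \<rho> \<kappa> \<psi> \<nu>)"
    by (simp add: ereal_le_epsilon2)
qed

text \<open>Feasibility makes the contribution of every \<nu> non-negative, and the zero measure
  makes it vanish.\<close>

lemma INF_lagrangian_feasible:
  assumes \<psi>: "\<psi> \<in> dual_feasible \<Omega> \<rho> \<kappa>"
  shows "(INF \<nu> \<in> radon_measures \<Omega>. lagrangian \<rho> \<kappa> \<psi> \<nu>) = ereal (dual_objective \<rho> \<psi>)"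
proof (rule antisym)
  have "lagrangian \<rho> \<kappa> \<psi> (null_measure (restrict_space borel \<Omega>)) = ereal (dual_objective \<rho> \<psi>)"
    by (simp add: lagrangian_def null_measure_radon(2) zero_ennreal.rep_eq)
  then show "(INF \<nu> \<in> radon_measures \<Omega>. lagrangian \<rho> \<kappa> \<psi> \<nu>) \<le> ereal (dual_objective \<rho> \<psi>)"
    by (intro INF_lower2[OF null_measure_radon(1)]) simp
  show "ereal (dual_objective \<rho> \<psi>) \<le> (INF \<nu> \<in> radon_measures \<Omega>. lagrangian \<rho> \<kappa> \<psi> \<nu>)"
  proof (rule INF_greatest)
    fix \<nu> assume \<nu>: "\<nu> \<in> radon_measures \<Omega>"
    note q = feasible_quotient[OF \<nu> \<psi>]
    show "ereal (dual_objective \<rho> \<psi>) \<le> lagrangian \<rho> \<kappa> \<psi> \<nu>"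
      unfolding lagrangian_def q(2) using q(3,4) radon_measuresD(2)[OF \<nu>] by simp
  qed
qed

text \<open>Heavy point masses at a point where the constraint fails drive the Lagrangian below
  every real bound.\<close>

lemma INF_lagrangian_infeasible:
  assumes \<psi>: "\<psi> \<in> dual_potentials \<Omega> \<rho>" "\<psi> \<notin> dual_feasible \<Omega> \<rho> \<kappa>"
  shows "(INF \<nu> \<in> radon_measures \<Omega>. lagrangian \<rho> \<kappa> \<psi> \<nu>) = -\<infinity>"
proof (rule ereal_bot)
  fix B :: real
  obtain y where y: "y \<in> \<Omega>" "1 < dual_potential \<rho> \<kappa> \<psi> y"
    using \<psi> by (auto simp: dual_feasible_def not_le)
  \<comment> \<open>The potential may be infinite at \<open>y\<close>; a real number above 1 and
    below it suffices, for instance 2 in the infinite case.\<close>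
  obtain c where c: "1 < c" "ennreal c \<le> dual_potential \<rho> \<kappa> \<psi> y"
  proof (cases "dual_potential \<rho> \<kappa> \<psi> y")
    case (real r)
    then show ?thesis using y(2) by (intro that[of r]) auto
  qed (use that[of 2] in auto)
  \<comment> \<open>Each unit of mass at \<open>y\<close> lowers the Lagrangian by at least
    \<open>c - 1\<close>, so this weight brings it down to \<open>B\<close>.\<close>
  define n where "n = \<bar>dual_objective \<rho> \<psi> - B\<bar> / (c - 1)"
  have n: "0 \<le> n" using c by (simp add: n_def)
  let ?N = "restrict_space borel \<Omega> :: 'a measure"
  have sN: "y \<in> space ?N" using y by (simp add: space_restrict_space)
  have ret: "return ?N y \<in> radon_measures \<Omega>"
    using prob_space_return[OF sN] by (simp add: radon_measures_def prob_space.finite_measure)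
  define \<nu> where "\<nu> = scale_measure (ennreal n) (return ?N y)"
  have \<nu>: "\<nu> \<in> radon_measures \<Omega>" unfolding \<nu>_def by (rule scale_radon_measure(1)[OF ret n])
  have "\<Omega> \<in> sets ?N" using sets.top[of ?N] by (simp add: space_restrict_space)
  then have mass: "measure \<nu> (space \<nu>) = n"
    using scale_radon_measure(2)[OF ret n] y n
    by (simp add: radon_measuresD(2)[OF \<nu>]) (simp add: \<nu>_def measure_return)
  have "(\<integral>\<^sup>+z. dual_potential \<rho> \<kappa> \<psi> z \<partial>\<nu>) = ennreal n * dual_potential \<rho> \<kappa> \<psi> y"
    using dual_potential_measurable[OF ret \<psi>(1)] sN
    by (simp add: \<nu>_def nn_integral_scale_measure nn_integral_return)
  also have "ennreal (n * c) \<le> \<dots>"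
    using c n by (simp add: ennreal_mult mult_left_mono)
  finally have "enn2ereal (ennreal (n * c)) \<le> enn2ereal (\<integral>\<^sup>+z. dual_potential \<rho> \<kappa> \<psi> z \<partial>\<nu>)"
    by (simp only: less_eq_ennreal.rep_eq)
  then have *: "ereal (n * c) \<le> enn2ereal (\<integral>\<^sup>+z. dual_potential \<rho> \<kappa> \<psi> z \<partial>\<nu>)"
    using c n by simp
  have "(INF \<nu> \<in> radon_measures \<Omega>. lagrangian \<rho> \<kappa> \<psi> \<nu>) \<le> lagrangian \<rho> \<kappa> \<psi> \<nu>"
    by (rule INF_lower[OF \<nu>])
  also have "\<dots> \<le> ereal (dual_objective \<rho> \<psi> + n) - ereal (n * c)"
    unfolding lagrangian_def mass by (intro ereal_minus_mono *) simp
  also have "\<dots> \<le> ereal B"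
  proof -
    have "n * (c - 1) = \<bar>dual_objective \<rho> \<psi> - B\<bar>" using c by (simp add: n_def)
    then show ?thesis by (simp add: algebra_simps)
  qed
  finally show "(INF \<nu> \<in> radon_measures \<Omega>. lagrangian \<rho> \<kappa> \<psi> \<nu>) \<le> ereal B" .
qed

lemma dual_problem: "is_dual_problem \<Omega> \<rho> \<kappa>"
  unfolding is_dual_problem_def
  using SUP_lagrangian INF_lagrangian_feasible INF_lagrangian_infeasible primal_value_nonneg
  by (auto simp: primal_objective_eq)

section \<open>Uniqueness and the optimality criterion\<close>

lemma dual_optimal_unique_on_support:
  assumes "dual_optimal \<Omega> \<rho> \<kappa> \<psi>\<^sub>1" "dual_optimal \<Omega> \<rho> \<kappa> \<psi>\<^sub>2" "x \<in> measure_support \<Omega> \<rho>"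
  shows "\<psi>\<^sub>1 x = \<psi>\<^sub>2 x"
proof (rule continuous_AE_eq_on_support[OF \<rho> _ _ _ assms(3)])
  obtain \<psi>\<^sub>0 where "\<And>\<psi>. dual_optimal \<Omega> \<rho> \<kappa> \<psi> \<Longrightarrow> AE x in \<rho>. \<psi> x = \<psi>\<^sub>0 x"
    using dual_optimum unfolding dual_optimal_iff by metis
  from this[OF assms(1)] this[OF assms(2)] show "AE x in \<rho>. \<psi>\<^sub>1 x = \<psi>\<^sub>2 x"
    by eventually_elim simp
qed (use assms dual_potentialsD(1)[OF dual_feasibleD(1)] in \<open>auto simp: dual_optimal_iff\<close>)

lemma optimal_iff_optimality_conditions:
  assumes \<nu>: "\<nu> \<in> radon_measures \<Omega>" and \<psi>: "\<psi> \<in> dual_feasible \<Omega> \<rho> \<kappa>"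
  shows "primal_optimal \<Omega> \<rho> \<kappa> \<nu> \<and> dual_optimal \<Omega> \<rho> \<kappa> \<psi> \<longleftrightarrow> optimality_conditions \<rho> \<kappa> \<nu> \<psi>"
proof -
  \<comment> \<open>\<open>primal_inf\<close> lies between the two values, so a zero gap is the same
    as optimality of both members of the couple.\<close>
  have "primal_value \<nu> = primal_inf \<and> dual_objective \<rho> \<psi> = primal_inf \<longleftrightarrow> dual_objective \<rho> \<psi> = primal_value \<nu>"
    using primal_inf_le[OF \<nu>] dual_objective_le_primal_inf[OF \<psi>] by linarith
  then show ?thesis
    using weak_duality(2)[OF \<nu> \<psi>] assms by (simp add: primal_optimal_iff dual_optimal_iff)
qed

end

theorem proposition4p4:
  fixes \<Omega> :: "'a::euclidean_space set" and \<rho> :: "'a measure" and \<kappa> :: real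
  assumes "compact \<Omega>" and "convex \<Omega>" and "interior \<Omega> \<noteq> {}"
    and "\<rho> \<in> radon_measures \<Omega>" and "prob_space \<rho>"
    and "0 < \<kappa>"
  shows
    "is_dual_problem \<Omega> \<rho> \<kappa> \<and>
     enn2ereal (INF \<nu> \<in> radon_measures \<Omega>. primal_objective \<Omega> \<rho> \<kappa> \<nu>) =
       (SUP \<psi> \<in> dual_feasible \<Omega> \<rho> \<kappa>. ereal (dual_objective \<rho> \<psi>)) \<and>
     enn2ereal (INF \<nu> \<in> radon_measures \<Omega>. primal_objective \<Omega> \<rho> \<kappa> \<nu>) =
       (SUP \<psi> \<in> {\<psi> \<in> dual_feasible \<Omega> \<rho> \<kappa>. \<forall>x\<in>\<Omega>. \<psi> x < 1}. ereal (dual_objective \<rho> \<psi>)) \<and>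

     (\<exists>\<psi>. dual_optimal \<Omega> \<rho> \<kappa> \<psi>) \<and>
     (\<forall>\<psi>\<^sub>1 \<psi>\<^sub>2. dual_optimal \<Omega> \<rho> \<kappa> \<psi>\<^sub>1 \<and> dual_optimal \<Omega> \<rho> \<kappa> \<psi>\<^sub>2 \<longrightarrow>
        (\<forall>x \<in> measure_support \<Omega> \<rho>. \<psi>\<^sub>1 x = \<psi>\<^sub>2 x)) \<and>
     (\<forall>\<psi> \<nu>. dual_optimal \<Omega> \<rho> \<kappa> \<psi> \<and> primal_optimal \<Omega> \<rho> \<kappa> \<nu> \<longrightarrow>
        optimality_conditions \<rho> \<kappa> \<nu> \<psi>) \<and>

     (\<forall>\<nu> \<psi>. \<nu> \<in> radon_measures \<Omega> \<and> \<psi> \<in> dual_feasible \<Omega> \<rho> \<kappa> \<longrightarrow>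
        (primal_optimal \<Omega> \<rho> \<kappa> \<nu> \<and> dual_optimal \<Omega> \<rho> \<kappa> \<psi> \<longleftrightarrow>
         optimality_conditions \<rho> \<kappa> \<nu> \<psi>))"
proof -
  interpret hk_barycenter \<Omega> \<rho> \<kappa>
    using assms by (intro hk_barycenter.intro)
  obtain \<psi>\<^sub>0 where \<psi>\<^sub>0: "dual_optimal \<Omega> \<rho> \<kappa> \<psi>\<^sub>0"
    using dual_optimum unfolding dual_optimal_iff by metis
  have inf: "enn2ereal (INF \<nu> \<in> radon_measures \<Omega>. primal_objective \<Omega> \<rho> \<kappa> \<nu>) = ereal primal_inf"
    using primal_inf_nonneg by (simp add: INF_primal_objective)
  have conditions: "optimality_conditions \<rho> \<kappa> \<nu> \<psi>"
    if "dual_optimal \<Omega> \<rho> \<kappa> \<psi>" "primal_optimal \<Omega> \<rho> \<kappa> \<nu>" for \<psi> \<nu>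
    using that optimal_iff_optimality_conditions[of \<nu> \<psi>] unfolding primal_optimal_iff dual_optimal_iff by blast
  show ?thesis
    unfolding inf SUP_dual_objective SUP_dual_objective_strict
    using dual_problem \<psi>\<^sub>0 dual_optimal_unique_on_support conditions optimal_iff_optimality_conditions
    by blast
qed

end
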